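(* Let $p\in(1,\infty)$, let $G$ be a discrete group, and let $H$ be a subgroup of $G$. If $G$ has the $p$-invariant translation approximation property ($p$-ITAP), then $H$ has the $p$-ITAP.
   Context: Convention: a discrete group $\Gamma$ is equipped with a proper right-invariant metric $d$ (i.e. $d(sg,tg)=d(s,t)$ and all balls are finite; in particular $\Gamma$ is countable), and $|\Gamma|$ denotes the resulting metric space, which has bounded geometry. For $T\in B(\ell^p(\Gamma))$ write $T_{s,t}=\langle T\delta_t,\delta_s\rangle$ and $\mathrm{prop}(T)=\sup\{d(s,t):T_{s,t}\neq0\}$. $B^p_u|\Gamma|$ is the operator norm closure in $B(\ell^p(\Gamma))$ of the algebra of operators with finite propagation. (An operator has finite propagation iff there is a finite $F\subseteq\Gamma$ with $T_{s,t}=0$ unless $st^{-1}\in F$, so $B^p_u|\Gamma|$ does not depend on the metric chosen.) The left and right regular representations on $\ell^p(\Gamma)$ are $(\lambda_sf)(t)=f(s^{-1}t)$ and $(\rho_sf)(t)=f(ts)$. $F^p_\lambda(\Gamma)$ is the norm-closed subalgebra of $B(\ell^p(\Gamma))$ generated by $\lambda(\Gamma)$; it is contained in $B^p_u|\Gamma|$. $\Gamma$ acts on $B^p_u|\Gamma|$ by $\mathrm{Ad}(\rho_g)(T)=\rho_gT\rho_{g^{-1}}$, and $B^p_u|\Gamma|^\Gamma$ denotes the set of fixed points. For $1<p<\infty$, $\Gamma$ has the $p$-ITAP if $F^p_\lambda(\Gamma)=B^p_u|\Gamma|^\Gamma$. *)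

theory Defs
  imports "HOL-Algebra.Group" "HOL-Analysis.Abstract_Metric_Spaces" "HOL-Analysis.Infinite_Sum"
    "HOL-Library.Extended_Nonnegative_Real"
begin

section \<open>Discrete groups with a proper right-invariant metric\<close>

locale proper_metric_group = group G + Metric_space "carrier G" d
  for G :: "('a, 'b) monoid_scheme" (structure) and d :: "'a \<Rightarrow> 'a \<Rightarrow> real" +
  assumes right_invariant:
      "\<lbrakk>s \<in> carrier G; t \<in> carrier G; g \<in> carrier G\<rbrakk> \<Longrightarrow> d (s \<otimes> g) (t \<otimes> g) = d s t"
    and finite_balls: "x \<in> carrier G \<Longrightarrow> finite (mcball x r)"

section \<open>Operators on complex sequence spaces\<close>

text \<open>Elements of \<open>\<ell>\<^sup>p(S)\<close> are complex functions on the whole type that vanish off \<open>S\<close>.\<close>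

definition lp_space :: "real \<Rightarrow> 'a set \<Rightarrow> ('a \<Rightarrow> complex) set" where
  "lp_space p S = {f. (\<forall>x. x \<notin> S \<longrightarrow> f x = 0) \<and> (\<lambda>x. cmod (f x) powr p) summable_on S}"

definition lp_norm :: "real \<Rightarrow> 'a set \<Rightarrow> ('a \<Rightarrow> complex) \<Rightarrow> real" where
  "lp_norm p S f = (\<Sum>\<^sub>\<infinity>x\<in>S. cmod (f x) powr p) powr (1 / p)"

definition delta :: "'a \<Rightarrow> 'a \<Rightarrow> complex" where
  "delta t = (\<lambda>x. if x = t then 1 else 0)"

type_synonym 'a operator = "('a \<Rightarrow> complex) \<Rightarrow> ('a \<Rightarrow> complex)"

text \<open>Operators are extensional on \<open>\<ell>\<^sup>p(S)\<close>, so that HOL equality of two elements of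
  \<open>B(\<ell>\<^sup>p(S))\<close> is equality as maps on \<open>\<ell>\<^sup>p(S)\<close>; products are given by \<^const>\<open>compose\<close>.\<close>

definition bounded_ops :: "real \<Rightarrow> 'a set \<Rightarrow> 'a operator set" where
  "bounded_ops p S = {T. T \<in> lp_space p S \<rightarrow>\<^sub>E lp_space p S
     \<and> (\<forall>f\<in>lp_space p S. \<forall>g\<in>lp_space p S. T (\<lambda>x. f x + g x) = (\<lambda>x. T f x + T g x))
     \<and> (\<forall>c. \<forall>f\<in>lp_space p S. T (\<lambda>x. c * f x) = (\<lambda>x. c * T f x))
     \<and> (\<exists>C. \<forall>f\<in>lp_space p S. lp_norm p S (T f) \<le> C * lp_norm p S f)}"

definition op_add :: "real \<Rightarrow> 'a set \<Rightarrow> 'a operator \<Rightarrow> 'a operator \<Rightarrow> 'a operator" where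
  "op_add p S T U = (\<lambda>f\<in>lp_space p S. \<lambda>x. T f x + U f x)"

definition op_diff :: "real \<Rightarrow> 'a set \<Rightarrow> 'a operator \<Rightarrow> 'a operator \<Rightarrow> 'a operator" where
  "op_diff p S T U = (\<lambda>f\<in>lp_space p S. \<lambda>x. T f x - U f x)"

definition op_scale :: "real \<Rightarrow> 'a set \<Rightarrow> complex \<Rightarrow> 'a operator \<Rightarrow> 'a operator" where
  "op_scale p S c T = (\<lambda>f\<in>lp_space p S. \<lambda>x. c * T f x)"

definition op_norm :: "real \<Rightarrow> 'a set \<Rightarrow> 'a operator \<Rightarrow> real" where
  "op_norm p S T = Sup {lp_norm p S (T f) | f. f \<in> lp_space p S \<and> lp_norm p S f \<le> 1}"

definition op_closure :: "real \<Rightarrow> 'a set \<Rightarrow> 'a operator set \<Rightarrow> 'a operator set" where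
  "op_closure p S A =
     {T \<in> bounded_ops p S. \<forall>e>0. \<exists>U\<in>A. op_norm p S (op_diff p S T U) < e}"

text \<open>Subalgebras are not required to contain the identity operator.\<close>

definition closed_subalgebra :: "real \<Rightarrow> 'a set \<Rightarrow> 'a operator set \<Rightarrow> bool" where
  "closed_subalgebra p S A \<longleftrightarrow>
     A \<noteq> {} \<and> A \<subseteq> bounded_ops p S
     \<and> (\<forall>T\<in>A. \<forall>U\<in>A. op_add p S T U \<in> A)
     \<and> (\<forall>c. \<forall>T\<in>A. op_scale p S c T \<in> A)
     \<and> (\<forall>T\<in>A. \<forall>U\<in>A. compose (lp_space p S) T U \<in> A)
     \<and> op_closure p S A = A"

section \<open>The uniform Roe algebra and the reduced group algebra\<close>

definition matrix_entry :: "'a operator \<Rightarrow> 'a \<Rightarrow> 'a \<Rightarrow> complex" where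
  "matrix_entry T s t = T (delta t) s"

definition propagation :: "'a set \<Rightarrow> ('a \<Rightarrow> 'a \<Rightarrow> real) \<Rightarrow> 'a operator \<Rightarrow> ennreal" where
  "propagation S d T = Sup {ennreal (d s t) | s t. s \<in> S \<and> t \<in> S \<and> matrix_entry T s t \<noteq> 0}"

definition uniform_roe :: "real \<Rightarrow> 'a set \<Rightarrow> ('a \<Rightarrow> 'a \<Rightarrow> real) \<Rightarrow> 'a operator set" where
  "uniform_roe p S d = op_closure p S {T \<in> bounded_ops p S. propagation S d T < \<infinity>}"

definition left_reg :: "real \<Rightarrow> ('a, 'b) monoid_scheme \<Rightarrow> 'a \<Rightarrow> 'a operator" where
  "left_reg p G s = (\<lambda>f\<in>lp_space p (carrier G).
     \<lambda>t. if t \<in> carrier G then f (inv\<^bsub>G\<^esub> s \<otimes>\<^bsub>G\<^esub> t) else 0)"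

definition right_reg :: "real \<Rightarrow> ('a, 'b) monoid_scheme \<Rightarrow> 'a \<Rightarrow> 'a operator" where
  "right_reg p G s = (\<lambda>f\<in>lp_space p (carrier G).
     \<lambda>t. if t \<in> carrier G then f (t \<otimes>\<^bsub>G\<^esub> s) else 0)"

definition reduced_group_algebra :: "real \<Rightarrow> ('a, 'b) monoid_scheme \<Rightarrow> 'a operator set" where
  "reduced_group_algebra p G =
     closed_subalgebra p (carrier G) hull (left_reg p G ` carrier G)"

definition Ad_right_reg ::
    "real \<Rightarrow> ('a, 'b) monoid_scheme \<Rightarrow> 'a \<Rightarrow> 'a operator \<Rightarrow> 'a operator" where
  "Ad_right_reg p G g T =
     compose (lp_space p (carrier G)) (right_reg p G g)
       (compose (lp_space p (carrier G)) T (right_reg p G (inv\<^bsub>G\<^esub> g)))"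

definition invariant_uniform_roe ::
    "real \<Rightarrow> ('a, 'b) monoid_scheme \<Rightarrow> ('a \<Rightarrow> 'a \<Rightarrow> real) \<Rightarrow> 'a operator set" where
  "invariant_uniform_roe p G d =
     {T \<in> uniform_roe p (carrier G) d. \<forall>g\<in>carrier G. Ad_right_reg p G g T = T}"

definition p_ITAP :: "real \<Rightarrow> ('a, 'b) monoid_scheme \<Rightarrow> ('a \<Rightarrow> 'a \<Rightarrow> real) \<Rightarrow> bool" where
  "p_ITAP p G d \<longleftrightarrow> reduced_group_algebra p G = invariant_uniform_roe p G d"

end

theory Submission
  imports Defs "HOL-Analysis.Convex" "HOL-Algebra.Coset"
begin

text \<open>Since \<open>G\<close> is the disjoint union of the cosets \<open>H #> g\<close>, each of them a copy of \<open>H\<close>, an operator \<open>T\<close>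
  on \<open>\<ell>\<^sup>p(H)\<close> acts blockwise on \<open>\<ell>\<^sup>p(G)\<close>. This extension does not increase the norm, keeps
  propagation finite, and is \<open>G\<close>-invariant when \<open>T\<close> is \<open>H\<close>-invariant, so the ITAP of \<open>G\<close> approximates
  it by linear combinations of translations \<open>\<lambda>\<^sub>g\<close>. Cutting down to \<open>\<ell>\<^sup>p(H)\<close> is a contraction which
  returns \<open>T\<close>, keeps \<open>\<lambda>\<^sub>g\<close> for \<open>g \<in> H\<close>, and kills it for \<open>g \<notin> H\<close>.\<close>

section \<open>Operators on sequence spaces\<close>

text \<open>Only one inclusion of the ITAP is at stake, as the translation algebra always lies in
  the invariant part of the Roe algebra. The metrics on \<open>G\<close> and \<open>H\<close> are
  chosen independently, so propagation bounds cannot be compared directly. By right invariance a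
  distance depends only on x t^{-1}, and for two points h g and k g of one right coset this quotient
  is h k^{-1}; properness makes a \<open>dH\<close>-ball of \<open>H\<close> a finite set, which is
  bounded for \<open>d\<close>. Identifying a coset with \<open>H\<close> takes a base point, and
  none is canonical. The extension is nevertheless needed for arbitrary bounded operators, because
  the finite propagation operators that approximate an invariant \<open>T\<close> need not be
  invariant. Norm and propagation estimates hold for any base points; for invariant \<open>T\<close>
  the choice drops out altogether. Cutting down is not multiplicative: for g outside
  \<open>H\<close> it sends \<lambda>_g and its inverse to zero, but their product to the identity.
  The translation algebra is therefore described as the closure of a linear span, where linearity of
  the cut-down is enough.\<close>

lemma powr_convex_nonneg:
  fixes p :: real
  assumes "1 \<le> p" "0 \<le> x" "0 \<le> y" "0 \<le> u" "0 \<le> v" "u + v = 1"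
  shows "(u * x + v * y) powr p \<le> u * x powr p + v * y powr p"
proof -
  \<comment> \<open>If one of the two points is zero, a single term survives; the claim then rests
    on w^p \<le> w for w in [0,1].\<close>
  have scale: "(w * z) powr p \<le> w * z powr p" if "0 \<le> w" "w \<le> 1" "0 \<le> z" for w z :: real
  proof -
    have "w powr p \<le> w"
      using that assms(1) powr_mono'[of 1 p w] by (cases "w = 0") auto
    then show ?thesis
      using that by (simp add: powr_mult mult_right_mono)
  qed
  show ?thesis
  proof (cases "x = 0 \<or> y = 0")
    case True
    then show ?thesis
      using assms scale[of v y] scale[of u x] by auto
  next
    case False
    then have "((1 - v) * x + v * y) powr p \<le> (1 - v) * x powr p + v * y powr p"
      using assms convex_onD[OF powr_convex[OF assms(1)], of v x y] by auto
    moreover have "u = 1 - v"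
      using assms(6) by simp
    ultimately show ?thesis
      by simp
  qed
qed

lemma lp_space_zero: "(\<lambda>x. 0) \<in> lp_space p S"
  by (simp add: lp_space_def)

lemma lp_norm_zero [simp]: "lp_norm p S (\<lambda>x. 0) = 0"
  by (simp add: lp_norm_def)

lemma lp_norm_nonneg [simp]: "0 \<le> lp_norm p S f"
  by (simp add: lp_norm_def)

lemma lp_space_off: "f \<in> lp_space p S \<Longrightarrow> x \<notin> S \<Longrightarrow> f x = 0"
  by (simp add: lp_space_def)

lemma lp_space_summable: "f \<in> lp_space p S \<Longrightarrow> (\<lambda>x. cmod (f x) powr p) summable_on S"
  by (simp add: lp_space_def)

lemma bounded_opsD:
  assumes "T \<in> bounded_ops p S"
  shows "f \<in> lp_space p S \<Longrightarrow> T f \<in> lp_space p S"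
    and "f \<notin> lp_space p S \<Longrightarrow> T f = undefined"
    and "f \<in> lp_space p S \<Longrightarrow> g \<in> lp_space p S \<Longrightarrow> T (\<lambda>x. f x + g x) = (\<lambda>x. T f x + T g x)"
    and "f \<in> lp_space p S \<Longrightarrow> T (\<lambda>x. c * f x) = (\<lambda>x. c * T f x)"
  using assms unfolding bounded_ops_def by (auto simp: PiE_def extensional_def)

lemma bounded_ops_zero:
  assumes "T \<in> bounded_ops p S"
  shows "T (\<lambda>x. 0) = (\<lambda>x. 0)"
  using bounded_opsD(4)[OF assms lp_space_zero, of 0] by simp

lemma op_apply:
  assumes "f \<in> lp_space p S"
  shows "op_add p S T U f = (\<lambda>x. T f x + U f x)"
    and "op_diff p S T U f = (\<lambda>x. T f x - U f x)"
    and "op_scale p S c T f = (\<lambda>x. c * T f x)"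
  using assms by (auto simp: op_add_def op_diff_def op_scale_def)

lemma op_diff_eq: "op_diff p S T U = op_add p S T (op_scale p S (-1) U)"
  by (auto simp: op_diff_def op_add_def op_scale_def fun_eq_iff)

locale lp_exponent =
  fixes p :: real
  assumes p: "1 < p"
begin

lemma lp_norm_powr: "lp_norm p S f powr p = (\<Sum>\<^sub>\<infinity>x\<in>S. cmod (f x) powr p)"
  using p by (simp add: lp_norm_def powr_powr infsum_nonneg)

text \<open>Allows Minkowski's inequality and restriction to a subset to be checked on finite sums,
  with summability as part of the outcome.\<close>

lemma lp_spaceI:
  assumes "\<And>x. x \<notin> S \<Longrightarrow> f x = 0" "0 \<le> C"
    and "\<And>F. finite F \<Longrightarrow> F \<subseteq> S \<Longrightarrow> (\<Sum>x\<in>F. cmod (f x) powr p) \<le> C powr p"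
  shows "f \<in> lp_space p S" "lp_norm p S f \<le> C"
proof -
  have *: "(\<lambda>x. cmod (f x) powr p) summable_on S"
    by (rule nonneg_bdd_above_summable_on) (use assms(3) in \<open>auto intro!: bdd_aboveI2\<close>)
  then show "f \<in> lp_space p S"
    using assms(1) by (simp add: lp_space_def)
  have "(\<Sum>\<^sub>\<infinity>x\<in>S. cmod (f x) powr p) \<le> C powr p"
    by (rule infsum_le_finite_sums[OF *]) (use assms in auto)
  then have "lp_norm p S f powr p \<le> C powr p"
    by (simp add: lp_norm_powr)
  then show "lp_norm p S f \<le> C"
    using p assms(2) by (meson lp_norm_nonneg less_trans not_le powr_less_mono2 zero_less_one)
qed

lemma lp_finite_sum_le:
  assumes "f \<in> lp_space p S" "finite F" "F \<subseteq> S"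
  shows "(\<Sum>x\<in>F. cmod (f x) powr p) \<le> lp_norm p S f powr p"
  unfolding lp_norm_powr
  by (rule finite_sum_le_infsum) (use assms in \<open>auto intro: lp_space_summable\<close>)

text \<open>Point evaluations are contractions. This makes the norm definite and lets identities
  between values pass to operator norm limits.\<close>

lemma lp_pointwise:
  assumes "f \<in> lp_space p S"
  shows "cmod (f x) \<le> lp_norm p S f"
proof (cases "x \<in> S")
  case True
  have "cmod (f x) powr p \<le> lp_norm p S f powr p"
    using lp_finite_sum_le[OF assms, of "{x}"] True by simp
  then show ?thesis
    using p by (meson norm_ge_zero lp_norm_nonneg less_trans not_le powr_less_mono2 zero_less_one)
qed (use assms in \<open>simp add: lp_space_off\<close>)

lemma lp_norm_eq_0:
  assumes "f \<in> lp_space p S" "lp_norm p S f = 0"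
  shows "f = (\<lambda>x. 0)"
  using lp_pointwise[OF assms(1)] assms(2) by (auto simp: fun_eq_iff)

lemma lp_scale:
  assumes "f \<in> lp_space p S"
  shows "(\<lambda>x. c * f x) \<in> lp_space p S"
    and "lp_norm p S (\<lambda>x. c * f x) = cmod c * lp_norm p S f"
proof -
  show "(\<lambda>x. c * f x) \<in> lp_space p S"
    using assms summable_on_cmult_right[of "\<lambda>x. cmod (f x) powr p" S "cmod c powr p"]
    by (simp add: lp_space_def norm_mult powr_mult)
  show "lp_norm p S (\<lambda>x. c * f x) = cmod c * lp_norm p S f"
    using p by (simp add: lp_norm_def norm_mult powr_mult infsum_cmult_right' powr_powr)
qed

text \<open>Minkowski's inequality: \<open>|f + g|\<close> is \<open>a + b\<close> times a convex combination of \<open>|f| / a\<close> and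
  \<open>|g| / b\<close>, where \<open>a\<close> and \<open>b\<close> are arbitrarily close to the two norms from above.\<close>

lemma lp_add:
  assumes f: "f \<in> lp_space p S" and g: "g \<in> lp_space p S"
  shows "(\<lambda>x. f x + g x) \<in> lp_space p S"
    and "lp_norm p S (\<lambda>x. f x + g x) \<le> lp_norm p S f + lp_norm p S g"
proof -
  \<comment> \<open>Strict upper bounds keep both denominators positive even when \<open>f\<close>
    or \<open>g\<close> is zero.\<close>
  have *: "(\<lambda>x. f x + g x) \<in> lp_space p S \<and> lp_norm p S (\<lambda>x. f x + g x) \<le> a + b"
    if a: "lp_norm p S f < a" and b: "lp_norm p S g < b" for a b
  proof -
    have pos: "0 < a" "0 < b"
      using a b lp_norm_nonneg[of p S f] lp_norm_nonneg[of p S g] by linarith+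
    have pt: "cmod (f x + g x) powr p
        \<le> (a + b) powr p * (a / (a + b) * (cmod (f x) powr p / a powr p)
             + b / (a + b) * (cmod (g x) powr p / b powr p))" for x
    proof -
      have "cmod (f x + g x) powr p \<le> (cmod (f x) + cmod (g x)) powr p"
        using p by (intro powr_mono2 norm_triangle_ineq) auto
      also have "cmod (f x) + cmod (g x)
          = (a + b) * (a / (a + b) * (cmod (f x) / a) + b / (a + b) * (cmod (g x) / b))"
        using pos by (simp add: distrib_left)
      also have "\<dots> powr p
          = (a + b) powr p * (a / (a + b) * (cmod (f x) / a) + b / (a + b) * (cmod (g x) / b)) powr p"
        using pos by (subst powr_mult) auto
      also have "\<dots> \<le> (a + b) powr p * (a / (a + b) * (cmod (f x) / a) powr p
            + b / (a + b) * (cmod (g x) / b) powr p)"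
        using pos p by (intro mult_left_mono powr_convex_nonneg) (auto simp flip: add_divide_distrib)
      finally show ?thesis
        using pos by (simp add: powr_divide)
    qed
    have fin: "(\<Sum>x\<in>F. cmod (f x + g x) powr p) \<le> (a + b) powr p" if F: "finite F" "F \<subseteq> S" for F
    proof -
      have "(\<Sum>x\<in>F. cmod (f x) powr p) / a powr p \<le> 1"
        using lp_finite_sum_le[OF f F] powr_mono2[of p "lp_norm p S f" a] a pos p
        by (simp add: divide_le_eq)
      moreover have "(\<Sum>x\<in>F. cmod (g x) powr p) / b powr p \<le> 1"
        using lp_finite_sum_le[OF g F] powr_mono2[of p "lp_norm p S g" b] b pos p
        by (simp add: divide_le_eq)
      ultimately have "(a + b) powr p * (a / (a + b) * ((\<Sum>x\<in>F. cmod (f x) powr p) / a powr p)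
            + b / (a + b) * ((\<Sum>x\<in>F. cmod (g x) powr p) / b powr p))
          \<le> (a + b) powr p * (a / (a + b) * 1 + b / (a + b) * 1)"
        using pos by (intro mult_left_mono add_mono) auto
      moreover have "a / (a + b) * 1 + b / (a + b) * 1 = 1"
        using pos by (simp flip: add_divide_distrib)
      moreover have "(\<Sum>x\<in>F. cmod (f x + g x) powr p)
          \<le> (a + b) powr p * (a / (a + b) * ((\<Sum>x\<in>F. cmod (f x) powr p) / a powr p)
            + b / (a + b) * ((\<Sum>x\<in>F. cmod (g x) powr p) / b powr p))"
        using sum_mono[of F "\<lambda>x. cmod (f x + g x) powr p", OF pt]
        by (simp only: sum.distrib sum_distrib_left sum_divide_distrib distrib_left)
      ultimately show ?thesis
        by simp
    qed
    show ?thesis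
      using lp_spaceI[of S "\<lambda>x. f x + g x" "a + b", OF _ _ fin] pos f g by (simp add: lp_space_off)
  qed
  show "(\<lambda>x. f x + g x) \<in> lp_space p S"
    using *[OF less_add_one less_add_one] by simp
  show "lp_norm p S (\<lambda>x. f x + g x) \<le> lp_norm p S f + lp_norm p S g"
  proof (rule field_le_epsilon)
    fix e :: real assume "0 < e"
    then show "lp_norm p S (\<lambda>x. f x + g x) \<le> lp_norm p S f + lp_norm p S g + e"
      using *[of "lp_norm p S f + e / 2" "lp_norm p S g + e / 2"] by simp
  qed
qed

lemma lp_reindex:
  assumes "bij_betw \<sigma> S S" "f \<in> lp_space p S"
  shows "(\<lambda>t. if t \<in> S then f (\<sigma> t) else 0) \<in> lp_space p S"
    and "lp_norm p S (\<lambda>t. if t \<in> S then f (\<sigma> t) else 0) = lp_norm p S f"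
proof -
  have "(\<lambda>t. cmod (if t \<in> S then f (\<sigma> t) else 0) powr p) summable_on S
      \<longleftrightarrow> (\<lambda>t. cmod (f (\<sigma> t)) powr p) summable_on S"
    by (rule summable_on_cong) simp
  also have "\<dots> \<longleftrightarrow> (\<lambda>t. cmod (f t) powr p) summable_on S"
    by (rule summable_on_reindex_bij_betw[OF assms(1)])
  finally show "(\<lambda>t. if t \<in> S then f (\<sigma> t) else 0) \<in> lp_space p S"
    using assms(2) by (simp add: lp_space_def)
  have "(\<Sum>\<^sub>\<infinity>t\<in>S. cmod (if t \<in> S then f (\<sigma> t) else 0) powr p) = (\<Sum>\<^sub>\<infinity>t\<in>S. cmod (f (\<sigma> t)) powr p)"
    by (rule infsum_cong) simp
  also have "\<dots> = (\<Sum>\<^sub>\<infinity>t\<in>S. cmod (f t) powr p)"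
    by (rule infsum_reindex_bij_betw[OF assms(1)])
  finally show "lp_norm p S (\<lambda>t. if t \<in> S then f (\<sigma> t) else 0) = lp_norm p S f"
    by (simp add: lp_norm_def)
qed

text \<open>Functions vanish off their index set, so the smaller space is literally a subset of the
  larger one and no embedding operator is required.\<close>

lemma lp_subset:
  assumes "R \<subseteq> S" "f \<in> lp_space p R"
  shows "f \<in> lp_space p S" and "lp_norm p S f = lp_norm p R f"
proof -
  have off: "f x = 0" if "x \<notin> R" for x
    using assms(2) that by (rule lp_space_off)
  have "(\<lambda>x. cmod (f x) powr p) summable_on S \<longleftrightarrow> (\<lambda>x. cmod (f x) powr p) summable_on R"
    by (rule summable_on_cong_neutral) (use assms(1) off in auto)
  then show "f \<in> lp_space p S"
    using assms off by (auto simp: lp_space_def)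
  have "(\<Sum>\<^sub>\<infinity>x\<in>S. cmod (f x) powr p) = (\<Sum>\<^sub>\<infinity>x\<in>R. cmod (f x) powr p)"
    by (rule infsum_cong_neutral) (use assms(1) off in auto)
  then show "lp_norm p S f = lp_norm p R f"
    by (simp add: lp_norm_def)
qed

text \<open>The coordinate projection is contractive; slices along cosets and compression to the
  subgroup both rest on it.\<close>

lemma lp_restrict:
  assumes "R \<subseteq> S" "f \<in> lp_space p S"
  shows "(\<lambda>x. if x \<in> R then f x else 0) \<in> lp_space p R"
    and "lp_norm p R (\<lambda>x. if x \<in> R then f x else 0) \<le> lp_norm p S f"
proof -
  have "(\<Sum>x\<in>F. cmod (if x \<in> R then f x else 0) powr p) \<le> lp_norm p S f powr p"
    if "finite F" "F \<subseteq> R" for F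
  proof -
    have "(\<Sum>x\<in>F. cmod (if x \<in> R then f x else 0) powr p) = (\<Sum>x\<in>F. cmod (f x) powr p)"
      using that by (intro sum.cong) auto
    then show ?thesis
      using lp_finite_sum_le[OF assms(2), of F] that assms(1) by auto
  qed
  from lp_spaceI[of R "\<lambda>x. if x \<in> R then f x else 0", OF _ lp_norm_nonneg this]
  show "(\<lambda>x. if x \<in> R then f x else 0) \<in> lp_space p R"
    and "lp_norm p R (\<lambda>x. if x \<in> R then f x else 0) \<le> lp_norm p S f"
    by auto
qed

lemma delta_in_lp: "t \<in> S \<Longrightarrow> delta t \<in> lp_space p S"
proof -
  assume t: "t \<in> S"
  have "delta t \<in> lp_space p {t}"
    by (auto simp: lp_space_def delta_def)
  then show ?thesis
    using t lp_subset(1)[of "{t}" S "delta t"] by simp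
qed

section \<open>Bounded operators and the operator norm\<close>

lemma bounded_opsI:
  assumes "\<And>f. f \<notin> lp_space p S \<Longrightarrow> T f = undefined"
    and "\<And>f. f \<in> lp_space p S \<Longrightarrow> T f \<in> lp_space p S"
    and "\<And>f g. f \<in> lp_space p S \<Longrightarrow> g \<in> lp_space p S \<Longrightarrow> T (\<lambda>x. f x + g x) = (\<lambda>x. T f x + T g x)"
    and "\<And>f c. f \<in> lp_space p S \<Longrightarrow> T (\<lambda>x. c * f x) = (\<lambda>x. c * T f x)"
    and "\<And>f. f \<in> lp_space p S \<Longrightarrow> lp_norm p S (T f) \<le> C * lp_norm p S f"
  shows "T \<in> bounded_ops p S"
proof -
  have "\<exists>C. \<forall>f\<in>lp_space p S. lp_norm p S (T f) \<le> C * lp_norm p S f"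
    using assms(5) by blast
  then show ?thesis
    using assms(1-4) by (simp add: bounded_ops_def PiE_def extensional_def)
qed

lemma bounded_opsE:
  assumes "T \<in> bounded_ops p S"
  obtains C where "0 \<le> C" "\<And>f. f \<in> lp_space p S \<Longrightarrow> lp_norm p S (T f) \<le> C * lp_norm p S f"
proof -
  obtain C where C: "\<And>f. f \<in> lp_space p S \<Longrightarrow> lp_norm p S (T f) \<le> C * lp_norm p S f"
    using assms unfolding bounded_ops_def by blast
  show ?thesis
  proof (rule that[of "max C 0"])
    fix f assume "f \<in> lp_space p S"
    then show "lp_norm p S (T f) \<le> max C 0 * lp_norm p S f"
      using C[of f] by (meson dual_order.trans lp_norm_nonneg max.cobounded1 mult_right_mono)
  qed simp
qed

text \<open>A real \<open>Sup\<close> dominates the elements of a set only if the set is bounded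
  above, so this precedes any use of \<open>op_norm\<close> as an upper bound.\<close>

lemma op_norm_bdd:
  assumes "T \<in> bounded_ops p S"
  shows "bdd_above {lp_norm p S (T f) | f. f \<in> lp_space p S \<and> lp_norm p S f \<le> 1}"
proof -
  obtain C where C: "0 \<le> C" "\<And>f. f \<in> lp_space p S \<Longrightarrow> lp_norm p S (T f) \<le> C * lp_norm p S f"
    by (rule bounded_opsE[OF assms]) blast
  have "lp_norm p S (T f) \<le> C" if "f \<in> lp_space p S" "lp_norm p S f \<le> 1" for f
    using C(2)[OF that(1)] mult_left_mono[OF that(2) C(1)] by simp
  then show ?thesis
    by (auto intro!: bdd_aboveI)
qed

lemma op_norm_nonneg:
  assumes "T \<in> bounded_ops p S"
  shows "0 \<le> op_norm p S T"
proof -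
  have "lp_norm p S (T (\<lambda>x. 0)) \<le> op_norm p S T"
    unfolding op_norm_def by (rule cSup_upper[OF _ op_norm_bdd[OF assms]])
      (auto simp: lp_space_zero intro!: exI[of _ "\<lambda>x. 0"])
  then show ?thesis
    using lp_norm_nonneg[of p S "T (\<lambda>x. 0)"] by linarith
qed

text \<open>Rescaling to norm one passes from the unit ball to all vectors. A vector of norm zero
  cannot be rescaled, but it is the zero function, which \<open>T\<close> annihilates.\<close>

lemma op_norm_bound:
  assumes T: "T \<in> bounded_ops p S" and f: "f \<in> lp_space p S"
  shows "lp_norm p S (T f) \<le> op_norm p S T * lp_norm p S f"
proof (cases "lp_norm p S f = 0")
  case True
  then have "f = (\<lambda>x. 0)"
    using f by (rule lp_norm_eq_0[rotated])
  then show ?thesis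
    using bounded_ops_zero[OF T] by simp
next
  case False
  define c where "c = lp_norm p S f"
  have c: "0 < c"
    using False lp_norm_nonneg[of p S f] unfolding c_def by linarith
  let ?g = "\<lambda>x. complex_of_real (1 / c) * f x"
  have g: "?g \<in> lp_space p S" "lp_norm p S ?g \<le> 1"
    using lp_scale[OF f, of "complex_of_real (1 / c)"] c by (auto simp: norm_divide c_def)
  have "lp_norm p S (T ?g) \<le> op_norm p S T"
    unfolding op_norm_def by (rule cSup_upper[OF _ op_norm_bdd[OF T]]) (use g in blast)
  moreover have "lp_norm p S (T ?g) = 1 / c * lp_norm p S (T f)"
    using c by (simp add: bounded_opsD(4)[OF T f] lp_scale(2)[OF bounded_opsD(1)[OF T f]] norm_divide
        del: of_real_divide)
  ultimately show ?thesis
    using c by (simp add: c_def field_simps)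
qed

lemma op_norm_leI:
  assumes "0 \<le> C" "\<And>f. f \<in> lp_space p S \<Longrightarrow> lp_norm p S (T f) \<le> C * lp_norm p S f"
  shows "op_norm p S T \<le> C"
  unfolding op_norm_def
proof (rule cSup_least)
  show "{lp_norm p S (T f) | f. f \<in> lp_space p S \<and> lp_norm p S f \<le> 1} \<noteq> {}"
    by (auto simp: lp_space_zero intro!: exI[of _ "\<lambda>x. 0"])
next
  fix y assume "y \<in> {lp_norm p S (T f) | f. f \<in> lp_space p S \<and> lp_norm p S f \<le> 1}"
  then obtain f where f: "y = lp_norm p S (T f)" "f \<in> lp_space p S" "lp_norm p S f \<le> 1"
    by blast
  show "y \<le> C"
    using assms(2)[OF f(2)] mult_left_mono[OF f(3) assms(1)] f(1) by simp
qed

lemma op_add_bounded: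
  assumes T: "T \<in> bounded_ops p S" and U: "U \<in> bounded_ops p S"
  shows "op_add p S T U \<in> bounded_ops p S" "op_norm p S (op_add p S T U) \<le> op_norm p S T + op_norm p S U"
proof -
  have le: "lp_norm p S (op_add p S T U f) \<le> (op_norm p S T + op_norm p S U) * lp_norm p S f"
    if f: "f \<in> lp_space p S" for f
    using lp_add(2)[OF bounded_opsD(1)[OF T f] bounded_opsD(1)[OF U f]]
      op_norm_bound[OF T f] op_norm_bound[OF U f]
    by (simp add: op_apply f distrib_right)
  show "op_add p S T U \<in> bounded_ops p S"
  proof (rule bounded_opsI)
    fix f g :: "'a \<Rightarrow> complex" and k assume f: "f \<in> lp_space p S"
    show "op_add p S T U f \<in> lp_space p S"
      by (simp add: op_apply f lp_add bounded_opsD(1)[OF T] bounded_opsD(1)[OF U])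
    show "op_add p S T U (\<lambda>x. k * f x) = (\<lambda>x. k * op_add p S T U f x)"
      by (simp only: op_apply f lp_scale bounded_opsD(4)[OF T] bounded_opsD(4)[OF U] distrib_left)
    assume g: "g \<in> lp_space p S"
    show "op_add p S T U (\<lambda>x. f x + g x) = (\<lambda>x. op_add p S T U f x + op_add p S T U g x)"
      by (simp only: op_apply f g lp_add bounded_opsD(3)[OF T] bounded_opsD(3)[OF U] ac_simps)
  qed (use le in \<open>auto simp: op_add_def\<close>)
  show "op_norm p S (op_add p S T U) \<le> op_norm p S T + op_norm p S U"
    using le by (intro op_norm_leI) (auto simp: op_norm_nonneg T U)
qed

lemma op_scale_bounded:
  assumes T: "T \<in> bounded_ops p S"
  shows "op_scale p S c T \<in> bounded_ops p S" "op_norm p S (op_scale p S c T) \<le> cmod c * op_norm p S T"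
proof -
  have le: "lp_norm p S (op_scale p S c T f) \<le> (cmod c * op_norm p S T) * lp_norm p S f"
    if f: "f \<in> lp_space p S" for f
    using mult_left_mono[OF op_norm_bound[OF T f], of "cmod c"]
    by (simp add: op_apply f lp_scale(2)[OF bounded_opsD(1)[OF T f]] mult.assoc)
  show "op_scale p S c T \<in> bounded_ops p S"
  proof (rule bounded_opsI)
    fix f g :: "'a \<Rightarrow> complex" and k assume f: "f \<in> lp_space p S"
    show "op_scale p S c T f \<in> lp_space p S"
      by (simp add: op_apply f lp_scale bounded_opsD(1)[OF T])
    show "op_scale p S c T (\<lambda>x. k * f x) = (\<lambda>x. k * op_scale p S c T f x)"
      by (simp only: op_apply f lp_scale bounded_opsD(4)[OF T] mult.left_commute)
    assume g: "g \<in> lp_space p S"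
    show "op_scale p S c T (\<lambda>x. f x + g x) = (\<lambda>x. op_scale p S c T f x + op_scale p S c T g x)"
      by (simp only: op_apply f g lp_add bounded_opsD(3)[OF T] distrib_left)
  qed (use le in \<open>auto simp: op_scale_def\<close>)
  show "op_norm p S (op_scale p S c T) \<le> cmod c * op_norm p S T"
    using le by (intro op_norm_leI) (auto simp: op_norm_nonneg T)
qed

lemma op_diff_bounded:
  assumes T: "T \<in> bounded_ops p S" and U: "U \<in> bounded_ops p S"
  shows "op_diff p S T U \<in> bounded_ops p S"
  using assms by (simp add: op_diff_eq op_add_bounded op_scale_bounded)

lemma op_compose_bounded:
  assumes T: "T \<in> bounded_ops p S" and U: "U \<in> bounded_ops p S"
  shows "compose (lp_space p S) T U \<in> bounded_ops p S"
    "op_norm p S (compose (lp_space p S) T U) \<le> op_norm p S T * op_norm p S U"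
proof -
  have le: "lp_norm p S (compose (lp_space p S) T U f) \<le> (op_norm p S T * op_norm p S U) * lp_norm p S f"
    if f: "f \<in> lp_space p S" for f
    using order_trans[OF op_norm_bound[OF T bounded_opsD(1)[OF U f]]
        mult_left_mono[OF op_norm_bound[OF U f] op_norm_nonneg[OF T]]]
    by (simp add: compose_def f mult.assoc)
  show "compose (lp_space p S) T U \<in> bounded_ops p S"
    using le by (intro bounded_opsI) (auto simp: compose_def lp_add lp_scale bounded_opsD[OF T]
        bounded_opsD[OF U])
  show "op_norm p S (compose (lp_space p S) T U) \<le> op_norm p S T * op_norm p S U"
    using le by (intro op_norm_leI) (auto simp: op_norm_nonneg T U)
qed

lemma op_norm_diff_triangle:
  assumes "T \<in> bounded_ops p S" "U \<in> bounded_ops p S" "V \<in> bounded_ops p S"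
  shows "op_norm p S (op_diff p S T V) \<le> op_norm p S (op_diff p S T U) + op_norm p S (op_diff p S U V)"
proof -
  have "op_diff p S T V = op_add p S (op_diff p S T U) (op_diff p S U V)"
    by (auto simp: op_diff_def op_add_def fun_eq_iff)
  then show ?thesis
    using op_add_bounded(2)[OF op_diff_bounded op_diff_bounded] assms by simp
qed

lemma op_norm_diff_self: "op_norm p S (op_diff p S T T) \<le> 0"
  by (rule op_norm_leI) (auto simp: op_apply)

section \<open>Norm closures and closed subalgebras\<close>

lemma op_closure_subset: "op_closure p S A \<subseteq> bounded_ops p S"
  by (auto simp: op_closure_def)

lemma op_closure_increasing:
  assumes "A \<subseteq> bounded_ops p S"
  shows "A \<subseteq> op_closure p S A"
  unfolding op_closure_def using assms op_norm_diff_self by (fastforce intro: order.strict_trans1)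

lemma op_closure_mono: "A \<subseteq> B \<Longrightarrow> op_closure p S A \<subseteq> op_closure p S B"
  unfolding op_closure_def by fast

lemma op_closure_idem:
  assumes A: "A \<subseteq> bounded_ops p S"
  shows "op_closure p S (op_closure p S A) = op_closure p S A"
proof (rule antisym)
  show "op_closure p S (op_closure p S A) \<subseteq> op_closure p S A"
  proof
    fix T assume T: "T \<in> op_closure p S (op_closure p S A)"
    then have Tb: "T \<in> bounded_ops p S"
      by (simp add: op_closure_def)
    have "\<exists>V\<in>A. op_norm p S (op_diff p S T V) < e" if e: "e > 0" for e
    proof -
      obtain U where U: "U \<in> op_closure p S A" "op_norm p S (op_diff p S T U) < e / 2"
        using T e unfolding op_closure_def by (auto dest: spec[of _ "e / 2"])
      then obtain V where V: "V \<in> A" "op_norm p S (op_diff p S U V) < e / 2"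
        using e unfolding op_closure_def by (auto dest: spec[of _ "e / 2"])
      have "op_norm p S (op_diff p S T V) < e"
        using op_norm_diff_triangle[OF Tb, of U V] U V A op_closure_subset[of S A] by fastforce
      with V show ?thesis by blast
    qed
    with Tb show "T \<in> op_closure p S A"
      by (simp add: op_closure_def)
  qed
  show "op_closure p S A \<subseteq> op_closure p S (op_closure p S A)"
    by (rule op_closure_increasing[OF op_closure_subset])
qed

lemma op_closureE:
  assumes "T \<in> op_closure p S A" "0 < e"
  obtains U where "U \<in> A" "op_norm p S (op_diff p S T U) < e"
  using assms unfolding op_closure_def by blast

text \<open>The algebra operations are continuous in the operator norm, so approximants of the
  arguments combine to approximants of the result.\<close>

lemma closed_subalgebra_closure:
  assumes ne: "A \<noteq> {}" and A: "A \<subseteq> bounded_ops p S"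
    and add: "\<And>T U. T \<in> A \<Longrightarrow> U \<in> A \<Longrightarrow> op_add p S T U \<in> A"
    and scale: "\<And>c T. T \<in> A \<Longrightarrow> op_scale p S c T \<in> A"
    and comp: "\<And>T U. T \<in> A \<Longrightarrow> U \<in> A \<Longrightarrow> compose (lp_space p S) T U \<in> A"
  shows "closed_subalgebra p S (op_closure p S A)"
proof -
  let ?L = "op_closure p S A"
  have b: "T \<in> bounded_ops p S" if "T \<in> ?L" for T
    using that op_closure_subset by blast
  have "op_add p S T U \<in> ?L" if T: "T \<in> ?L" and U: "U \<in> ?L" for T U
  proof -
    have "\<exists>W\<in>A. op_norm p S (op_diff p S (op_add p S T U) W) < e" if e: "e > 0" for e
    proof -
      obtain T' where T': "T' \<in> A" "op_norm p S (op_diff p S T T') < e / 2"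
        using op_closureE[OF T, of "e / 2"] e by auto
      obtain U' where U': "U' \<in> A" "op_norm p S (op_diff p S U U') < e / 2"
        using op_closureE[OF U, of "e / 2"] e by auto
      have "op_diff p S (op_add p S T U) (op_add p S T' U')
          = op_add p S (op_diff p S T T') (op_diff p S U U')"
        by (auto simp: op_diff_def op_add_def fun_eq_iff)
      then have "op_norm p S (op_diff p S (op_add p S T U) (op_add p S T' U')) < e"
        using op_add_bounded(2)[OF op_diff_bounded op_diff_bounded, of T S T' U U'] T U T' U' A b
        by fastforce
      then show ?thesis
        using add[OF T'(1) U'(1)] by blast
    qed
    then show ?thesis
      using op_add_bounded(1)[OF b[OF T] b[OF U]] by (simp add: op_closure_def)
  qed
  moreover have "op_scale p S c T \<in> ?L" if T: "T \<in> ?L" for c T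
  proof -
    have "\<exists>W\<in>A. op_norm p S (op_diff p S (op_scale p S c T) W) < e" if e: "e > 0" for e
    proof -
      \<comment> \<open>The summand 1 keeps the tolerance e / (cmod c + 1) meaningful when
        \<open>c\<close> is zero.\<close>
      have c: "0 < cmod c + 1"
        by (simp add: add_nonneg_pos)
      obtain T' where T': "T' \<in> A" "op_norm p S (op_diff p S T T') < e / (cmod c + 1)"
        using op_closureE[OF T, of "e / (cmod c + 1)"] e c by auto
      have D: "op_diff p S T T' \<in> bounded_ops p S"
        using op_diff_bounded T T' A b by blast
      have "op_diff p S (op_scale p S c T) (op_scale p S c T') = op_scale p S c (op_diff p S T T')"
        by (auto simp: op_diff_def op_scale_def fun_eq_iff right_diff_distrib)
      then have "op_norm p S (op_diff p S (op_scale p S c T) (op_scale p S c T'))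
          \<le> cmod c * op_norm p S (op_diff p S T T')"
        using op_scale_bounded(2)[OF D] by simp
      also have "\<dots> \<le> (cmod c + 1) * op_norm p S (op_diff p S T T')"
        using op_norm_nonneg[OF D] by (intro mult_right_mono) auto
      also have "\<dots> < e"
        using T'(2) c by (simp add: field_simps)
      finally show ?thesis
        using scale[OF T'(1)] by blast
    qed
    then show ?thesis
      using op_scale_bounded(1)[OF b[OF T]] by (simp add: op_closure_def)
  qed
  moreover have "compose (lp_space p S) T U \<in> ?L" if T: "T \<in> ?L" and U: "U \<in> ?L" for T U
  proof -
    have "\<exists>W\<in>A. op_norm p S (op_diff p S (compose (lp_space p S) T U) W) < e" if e: "e > 0" for e
    proof -
      \<comment> \<open>The error is split as T U - T' U' = (T - T') U + T' (U - U'). The second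
        term contains \<open>T'\<close>, so \<open>U'\<close> is chosen after \<open>T'\<close>,
        with a tolerance that depends on the norm of \<open>T'\<close>. Adding 1 makes
        \<open>u\<close> and \<open>t\<close> positive.\<close>
      define u where "u = op_norm p S U + 1"
      have u: "0 < u" "op_norm p S U \<le> u"
        using op_norm_nonneg[OF b[OF U]] by (auto simp: u_def)
      obtain T' where T': "T' \<in> A" "op_norm p S (op_diff p S T T') < e / (2 * u)"
        using op_closureE[OF T, of "e / (2 * u)"] e u by auto
      have T'b: "T' \<in> bounded_ops p S" and D: "op_diff p S T T' \<in> bounded_ops p S"
        using op_diff_bounded T T' A b by blast+
      define t where "t = op_norm p S T' + 1"
      have t: "0 < t" "op_norm p S T' \<le> t"
        using op_norm_nonneg[OF T'b] by (auto simp: t_def)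
      obtain U' where U': "U' \<in> A" "op_norm p S (op_diff p S U U') < e / (2 * t)"
        using op_closureE[OF U, of "e / (2 * t)"] e t by auto
      have U'b: "U' \<in> bounded_ops p S" and E: "op_diff p S U U' \<in> bounded_ops p S"
        using op_diff_bounded U U' A b by blast+
      have diff: "T' (\<lambda>x. f x - g x) = (\<lambda>x. T' f x - T' g x)"
        if "f \<in> lp_space p S" "g \<in> lp_space p S" for f g
        using bounded_opsD(3)[OF T'b that(1) lp_scale(1)[OF that(2), of "-1"]]
          bounded_opsD(4)[OF T'b that(2), of "-1"] by simp
      have "op_diff p S (compose (lp_space p S) T U) (compose (lp_space p S) T' U')
          = op_add p S (compose (lp_space p S) (op_diff p S T T') U)
              (compose (lp_space p S) T' (op_diff p S U U'))"
        using bounded_opsD(1)[OF b[OF U]] bounded_opsD(1)[OF U'b] diff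
        by (auto simp: op_diff_def op_add_def compose_def fun_eq_iff)
      then have "op_norm p S (op_diff p S (compose (lp_space p S) T U) (compose (lp_space p S) T' U'))
          \<le> op_norm p S (op_diff p S T T') * op_norm p S U + op_norm p S T' * op_norm p S (op_diff p S U U')"
        using op_add_bounded(2)[OF op_compose_bounded(1)[OF D b[OF U]] op_compose_bounded(1)[OF T'b E]]
          op_compose_bounded(2)[OF D b[OF U]] op_compose_bounded(2)[OF T'b E] by simp
      also have "\<dots> \<le> op_norm p S (op_diff p S T T') * u + t * op_norm p S (op_diff p S U U')"
        using u t op_norm_nonneg[OF D] op_norm_nonneg[OF E]
        by (intro add_mono mult_left_mono mult_right_mono) auto
      also have "\<dots> < e / 2 + e / 2"
        using T'(2) U'(2) u t by (intro add_strict_mono) (auto simp: field_simps)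
      finally show ?thesis
        using comp[OF T'(1) U'(1)] by auto
    qed
    then show ?thesis
      using op_compose_bounded(1)[OF b[OF T] b[OF U]] by (simp add: op_closure_def)
  qed
  moreover have "?L \<noteq> {}"
    using ne op_closure_increasing[OF A] by blast
  ultimately show ?thesis
    unfolding closed_subalgebra_def
    by (intro conjI op_closure_subset op_closure_idem[OF A]) simp_all
qed

end

section \<open>Translation operators\<close>

text \<open>Products are left out on purpose: induction then only meets linear operations, which
  compression respects. Closure under products is recovered in
  \<open>left_span_compose\<close>.\<close>

inductive_set left_span :: "real \<Rightarrow> ('a, 'b) monoid_scheme \<Rightarrow> 'a operator set" for p G where
  left_reg: "s \<in> carrier G \<Longrightarrow> left_reg p G s \<in> left_span p G"
| add: "T \<in> left_span p G \<Longrightarrow> U \<in> left_span p G \<Longrightarrow> op_add p (carrier G) T U \<in> left_span p G"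
| scale: "T \<in> left_span p G \<Longrightarrow> op_scale p (carrier G) c T \<in> left_span p G"

text \<open>Invariance under \<open>Ad_right_reg\<close> expressed on vectors, a form that passes
  easily to sums, blockwise extensions and limits.\<close>

definition commutes_right :: "real \<Rightarrow> ('a, 'b) monoid_scheme \<Rightarrow> 'a operator \<Rightarrow> bool" where
  "commutes_right p G T \<longleftrightarrow> (\<forall>g\<in>carrier G. \<forall>f\<in>lp_space p (carrier G).
     T (right_reg p G g f) = right_reg p G g (T f))"

lemma commutes_rightD:
  "commutes_right p G T \<Longrightarrow> g \<in> carrier G \<Longrightarrow> f \<in> lp_space p (carrier G)
    \<Longrightarrow> T (right_reg p G g f) = right_reg p G g (T f)"
  by (simp add: commutes_right_def)

lemma left_reg_apply:
  "f \<in> lp_space p (carrier G) \<Longrightarrow>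
    left_reg p G s f = (\<lambda>t. if t \<in> carrier G then f (inv\<^bsub>G\<^esub> s \<otimes>\<^bsub>G\<^esub> t) else 0)"
  by (simp add: left_reg_def)

lemma right_reg_apply:
  "f \<in> lp_space p (carrier G) \<Longrightarrow>
    right_reg p G s f = (\<lambda>t. if t \<in> carrier G then f (t \<otimes>\<^bsub>G\<^esub> s) else 0)"
  by (simp add: right_reg_def)

text \<open>Trades the extended supremum for a real bound on the support of the matrix. That
  \<open>ennreal\<close> sends negative reals to 0 is harmless, since a finite propagation is a
  nonnegative real.\<close>

lemma propagation_finite_iff:
  "propagation S d T < \<infinity> \<longleftrightarrow> (\<exists>N. \<forall>s\<in>S. \<forall>t\<in>S. matrix_entry T s t \<noteq> 0 \<longrightarrow> d s t \<le> N)"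
proof
  assume "propagation S d T < \<infinity>"
  then obtain r where r: "0 \<le> r" "propagation S d T = ennreal r"
    by (cases "propagation S d T") auto
  have "d s t \<le> r" if "s \<in> S" "t \<in> S" "matrix_entry T s t \<noteq> 0" for s t
  proof -
    have "ennreal (d s t) \<le> propagation S d T"
      unfolding propagation_def by (rule Sup_upper) (use that in blast)
    then show ?thesis
      using r by simp
  qed
  then show "\<exists>N. \<forall>s\<in>S. \<forall>t\<in>S. matrix_entry T s t \<noteq> 0 \<longrightarrow> d s t \<le> N"
    by blast
next
  assume "\<exists>N. \<forall>s\<in>S. \<forall>t\<in>S. matrix_entry T s t \<noteq> 0 \<longrightarrow> d s t \<le> N"
  then obtain N where "\<And>s t. s \<in> S \<Longrightarrow> t \<in> S \<Longrightarrow> matrix_entry T s t \<noteq> 0 \<Longrightarrow> d s t \<le> N"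
    by blast
  then have "propagation S d T \<le> ennreal N"
    unfolding propagation_def by (intro Sup_least) (auto intro!: ennreal_leI)
  then show "propagation S d T < \<infinity>"
    by (simp add: order_le_less_trans)
qed

text \<open>Translate both points on the right by \<open>inv t\<close>. A propagation bound thus
  confines s t^{-1} to a ball about \<one>, which is finite by properness.\<close>

lemma (in proper_metric_group) dist_eq_dist_one:
  assumes "s \<in> carrier G" "t \<in> carrier G"
  shows "d s t = d (s \<otimes> inv t) \<one>"
  using right_invariant[OF assms inv_closed[OF assms(2)]] assms by simp

locale lp_group = lp_exponent p + group G for p :: real and G :: "('a, 'b) monoid_scheme" (structure)
begin

text \<open>Both regular representations have this form, with \<sigma> a translation; reindexing by
  a bijection preserves the norm, whence the constant 1.\<close>

lemma reindex_op_bounded: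
  assumes "bij_betw \<sigma> S S"
  shows "(\<lambda>f\<in>lp_space p S. \<lambda>t. if t \<in> S then f (\<sigma> t) else 0) \<in> bounded_ops p S"
proof (rule bounded_opsI[where C = 1])
  have \<sigma>: "\<sigma> t \<in> S" if "t \<in> S" for t
    using assms that by (auto simp: bij_betw_def)
qed (auto simp: lp_reindex[OF assms] lp_add lp_scale fun_eq_iff)

lemma bij_betw_translations:
  assumes "s \<in> carrier G"
  shows "bij_betw (\<lambda>t. s \<otimes> t) (carrier G) (carrier G)" "bij_betw (\<lambda>t. t \<otimes> s) (carrier G) (carrier G)"
proof -
  show "bij_betw (\<lambda>t. s \<otimes> t) (carrier G) (carrier G)"
    by (rule bij_betw_byWitness[where f' = "\<lambda>t. inv s \<otimes> t"]) (use assms in \<open>auto simp flip: m_assoc\<close>)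
  show "bij_betw (\<lambda>t. t \<otimes> s) (carrier G) (carrier G)"
    by (rule bij_betw_byWitness[where f' = "\<lambda>t. t \<otimes> inv s"]) (use assms in \<open>auto simp: m_assoc\<close>)
qed

lemma left_reg_bounded: "s \<in> carrier G \<Longrightarrow> left_reg p G s \<in> bounded_ops p (carrier G)"
  unfolding left_reg_def by (intro reindex_op_bounded bij_betw_translations) simp

lemma right_reg_bounded: "s \<in> carrier G \<Longrightarrow> right_reg p G s \<in> bounded_ops p (carrier G)"
  unfolding right_reg_def by (intro reindex_op_bounded bij_betw_translations) simp

lemma right_reg_norm:
  assumes "s \<in> carrier G" "f \<in> lp_space p (carrier G)"
  shows "lp_norm p (carrier G) (right_reg p G s f) = lp_norm p (carrier G) f"
  using lp_reindex(2)[OF bij_betw_translations(2)[OF assms(1)] assms(2)] assms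
  by (simp add: right_reg_apply)

lemma right_reg_lp:
  "s \<in> carrier G \<Longrightarrow> f \<in> lp_space p (carrier G) \<Longrightarrow> right_reg p G s f \<in> lp_space p (carrier G)"
  using bounded_opsD(1)[OF right_reg_bounded] .

lemma right_reg_inverse:
  assumes "g \<in> carrier G" "f \<in> lp_space p (carrier G)"
  shows "right_reg p G g (right_reg p G (inv g) f) = f"
  using right_reg_lp[of "inv g", OF _ assms(2)] assms
  by (auto simp: right_reg_apply fun_eq_iff m_assoc lp_space_off)

lemma left_reg_mult:
  assumes "s \<in> carrier G" "t \<in> carrier G"
  shows "compose (lp_space p (carrier G)) (left_reg p G s) (left_reg p G t) = left_reg p G (s \<otimes> t)"
proof
  fix f
  show "compose (lp_space p (carrier G)) (left_reg p G s) (left_reg p G t) f = left_reg p G (s \<otimes> t) f"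
  proof (cases "f \<in> lp_space p (carrier G)")
    case True
    then show ?thesis
      using bounded_opsD(1)[OF left_reg_bounded[OF assms(2)] True] assms
      by (simp add: compose_def left_reg_apply fun_eq_iff inv_mult_group m_assoc)
  qed (simp add: compose_def left_reg_def)
qed

lemma left_span_bounded: "T \<in> left_span p G \<Longrightarrow> T \<in> bounded_ops p (carrier G)"
  by (induction rule: left_span.induct) (auto intro: left_reg_bounded op_add_bounded op_scale_bounded)

text \<open>Bilinearity of composition reduces the claim to \<lambda>_s \<lambda>_t =
  \<lambda>_{st}. Linearity in the left factor is a pointwise identity; in the right factor it uses
  that the left one, here a translation, is linear.\<close>

lemma left_span_compose:
  assumes "T \<in> left_span p G" and U: "U \<in> left_span p G"
  shows "compose (lp_space p (carrier G)) T U \<in> left_span p G"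
  using assms(1)
proof (induction rule: left_span.induct)
  case (left_reg s)
  note Lb = left_reg_bounded[OF left_reg]
  show ?case
    using U
  proof (induction rule: left_span.induct)
    case (left_reg t)
    then show ?case
      using \<open>s \<in> carrier G\<close> by (simp add: left_reg_mult left_span.left_reg)
  next
    case (add T U)
    have "compose (lp_space p (carrier G)) (left_reg p G s) (op_add p (carrier G) T U)
        = op_add p (carrier G) (compose (lp_space p (carrier G)) (left_reg p G s) T)
            (compose (lp_space p (carrier G)) (left_reg p G s) U)"
      using add.hyps[THEN left_span_bounded, THEN bounded_opsD(1)]
      by (auto simp: compose_def op_add_def fun_eq_iff bounded_opsD(3)[OF Lb])
    then show ?case
      using add.IH by (simp add: left_span.add)
  next
    case (scale T c)
    have "compose (lp_space p (carrier G)) (left_reg p G s) (op_scale p (carrier G) c T)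
        = op_scale p (carrier G) c (compose (lp_space p (carrier G)) (left_reg p G s) T)"
      using scale.hyps[THEN left_span_bounded, THEN bounded_opsD(1)]
      by (auto simp: compose_def op_scale_def fun_eq_iff bounded_opsD(4)[OF Lb])
    then show ?case
      using scale.IH by (simp add: left_span.scale)
  qed
next
  case (add T V)
  have "compose (lp_space p (carrier G)) (op_add p (carrier G) T V) U
      = op_add p (carrier G) (compose (lp_space p (carrier G)) T U) (compose (lp_space p (carrier G)) V U)"
    using U[THEN left_span_bounded, THEN bounded_opsD(1)]
    by (auto simp: compose_def op_add_def fun_eq_iff)
  then show ?case
    using add.IH by (simp add: left_span.add)
next
  case (scale T c)
  have "compose (lp_space p (carrier G)) (op_scale p (carrier G) c T) U
      = op_scale p (carrier G) c (compose (lp_space p (carrier G)) T U)"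
    using U[THEN left_span_bounded, THEN bounded_opsD(1)]
    by (auto simp: compose_def op_scale_def fun_eq_iff)
  then show ?case
    using scale.IH by (simp add: left_span.scale)
qed

text \<open>The closure of the span is itself a closed subalgebra. Any other one containing the
  translations contains their span, and by closedness also its closure.\<close>

lemma reduced_group_algebra_eq: "reduced_group_algebra p G = op_closure p (carrier G) (left_span p G)"
  unfolding reduced_group_algebra_def
proof (rule hull_unique)
  have sub: "left_span p G \<subseteq> bounded_ops p (carrier G)"
    using left_span_bounded by blast
  show "left_reg p G ` carrier G \<subseteq> op_closure p (carrier G) (left_span p G)"
    using op_closure_increasing[OF sub] left_span.left_reg[of _ G p] by blast
  show "closed_subalgebra p (carrier G) (op_closure p (carrier G) (left_span p G))"
    using left_span.left_reg[of \<one> G p]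
    by (intro closed_subalgebra_closure sub left_span_compose left_span.add left_span.scale) auto
next
  fix A assume A: "left_reg p G ` carrier G \<subseteq> A" "closed_subalgebra p (carrier G) A"
  have "T \<in> A" if "T \<in> left_span p G" for T
    using that A by (induction rule: left_span.induct) (auto simp: closed_subalgebra_def)
  then have "op_closure p (carrier G) (left_span p G) \<subseteq> op_closure p (carrier G) A"
    by (intro op_closure_mono) blast
  then show "op_closure p (carrier G) (left_span p G) \<subseteq> A"
    using A(2) by (simp add: closed_subalgebra_def)
qed

section \<open>Invariance as commutation with right translations\<close>

text \<open>Right translations by g and g^{-1} are mutually inverse, so one of them can be moved
  across the equation. Off the sequence space both operators take the value
  \<open>undefined\<close>, by extensionality.\<close>

lemma Ad_right_reg_fixed_iff:
  assumes T: "T \<in> bounded_ops p (carrier G)"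
  shows "(\<forall>g\<in>carrier G. Ad_right_reg p G g T = T) \<longleftrightarrow> commutes_right p G T"
proof -
  have Ad: "Ad_right_reg p G g T f = right_reg p G g (T (right_reg p G (inv g) f))"
    if "f \<in> lp_space p (carrier G)" for g f
    using that by (simp add: Ad_right_reg_def compose_def)
  show ?thesis
  proof
    assume fixed: "\<forall>g\<in>carrier G. Ad_right_reg p G g T = T"
    show "commutes_right p G T"
      unfolding commutes_right_def
    proof (intro ballI)
      fix g f assume g: "g \<in> carrier G" and f: "f \<in> lp_space p (carrier G)"
      have "T (right_reg p G g f) = Ad_right_reg p G g T (right_reg p G g f)"
        using fixed g by simp
      also have "\<dots> = right_reg p G g (T (right_reg p G (inv g) (right_reg p G g f)))"
        by (rule Ad[OF right_reg_lp[OF g f]])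
      also have "right_reg p G (inv g) (right_reg p G g f) = f"
        using right_reg_inverse[of "inv g" f] g f by simp
      finally show "T (right_reg p G g f) = right_reg p G g (T f)" .
    qed
  next
    assume comm: "commutes_right p G T"
    show "\<forall>g\<in>carrier G. Ad_right_reg p G g T = T"
    proof (rule ballI, rule ext)
      fix g f assume g: "g \<in> carrier G"
      show "Ad_right_reg p G g T f = T f"
      proof (cases "f \<in> lp_space p (carrier G)")
        case True
        then show ?thesis
          using commutes_rightD[OF comm g right_reg_lp[OF inv_closed[OF g] True]]
          by (simp add: Ad right_reg_inverse g)
      next
        case False
        then show ?thesis
          using bounded_opsD(2)[OF T] by (simp add: Ad_right_reg_def compose_def)
      qed
    qed
  qed
qed

text \<open>Associativity makes left and right translations commute; linearity does the
  rest.\<close>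

lemma left_span_commutes_right:
  assumes "T \<in> left_span p G"
  shows "commutes_right p G T"
  using assms
proof (induction rule: left_span.induct)
  case (left_reg s)
  then show ?case
    using right_reg_lp bounded_opsD(1)[OF left_reg_bounded]
    by (auto simp: commutes_right_def left_reg_apply right_reg_apply fun_eq_iff m_assoc)
next
  case (add T U)
  show ?case
    unfolding commutes_right_def
  proof (intro ballI)
    fix g f assume g: "g \<in> carrier G" and f: "f \<in> lp_space p (carrier G)"
    have "T f \<in> lp_space p (carrier G)" "U f \<in> lp_space p (carrier G)"
      using add.hyps[THEN left_span_bounded, THEN bounded_opsD(1)] f by blast+
    then show "op_add p (carrier G) T U (right_reg p G g f) = right_reg p G g (op_add p (carrier G) T U f)"
      using f g right_reg_lp[OF g f]
      by (simp add: op_apply add.IH[THEN commutes_rightD] bounded_opsD(3)[OF right_reg_bounded])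
  qed
next
  case (scale T c)
  show ?case
    unfolding commutes_right_def
  proof (intro ballI)
    fix g f assume g: "g \<in> carrier G" and f: "f \<in> lp_space p (carrier G)"
    have "T f \<in> lp_space p (carrier G)"
      using scale.hyps[THEN left_span_bounded, THEN bounded_opsD(1)] f by blast
    then show "op_scale p (carrier G) c T (right_reg p G g f) = right_reg p G g (op_scale p (carrier G) c T f)"
      using f g right_reg_lp[OF g f]
      by (simp add: op_apply scale.IH[THEN commutes_rightD] bounded_opsD(4)[OF right_reg_bounded])
  qed
qed

text \<open>For fixed \<open>f\<close> and \<open>x\<close>, both sides depend continuously on the
  operator, so the identity survives norm limits.\<close>

lemma op_closure_commutes_right:
  assumes T: "T \<in> op_closure p (carrier G) A" and A: "A \<subseteq> bounded_ops p (carrier G)"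
    and comm: "\<And>U. U \<in> A \<Longrightarrow> commutes_right p G U"
  shows "commutes_right p G T"
  unfolding commutes_right_def
proof (intro ballI ext)
  fix g f x assume g: "g \<in> carrier G" and f: "f \<in> lp_space p (carrier G)"
  note gf = right_reg_lp[OF g f]
  have Tb: "T \<in> bounded_ops p (carrier G)"
    using T op_closure_subset by blast
  show "T (right_reg p G g f) x = right_reg p G g (T f) x"
  proof (cases "x \<in> carrier G")
    case False
    then show ?thesis
      using lp_space_off[OF bounded_opsD(1)[OF Tb gf] False]
        lp_space_off[OF right_reg_lp[OF g bounded_opsD(1)[OF Tb f]] False] by simp
  next
    case x: True
    define c where "c = lp_norm p (carrier G) f"
    have "cmod (T (right_reg p G g f) x - right_reg p G g (T f) x) \<le> 0 + e" if e: "0 < e" for e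
    proof -
      have c: "0 \<le> c" "0 < 2 * (c + 1)"
        using lp_norm_nonneg[of p "carrier G" f] by (simp_all add: c_def add_nonneg_pos)
      \<comment> \<open>Replacing \<open>T\<close> by \<open>U\<close> on each side costs at most
        the norm of the difference times \<open>c\<close>, because \<open>right_reg\<close>
        preserves the norm of \<open>f\<close>; hence the factor 2. The summand 1 covers the case
        \<open>c = 0\<close>.\<close>
      obtain U where U: "U \<in> A" "op_norm p (carrier G) (op_diff p (carrier G) T U) < e / (2 * (c + 1))"
        using op_closureE[OF T, of "e / (2 * (c + 1))"] e c by auto
      let ?D = "op_diff p (carrier G) T U"
      have Ub: "U \<in> bounded_ops p (carrier G)"
        using U A by blast
      note D = op_diff_bounded[OF Tb Ub]
      have D_pointwise: "cmod (T h y - U h y) \<le> op_norm p (carrier G) ?D * lp_norm p (carrier G) h"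
        if h: "h \<in> lp_space p (carrier G)" for h y
        using order_trans[OF lp_pointwise[OF bounded_opsD(1)[OF D h], of y] op_norm_bound[OF D h]] h
        by (simp add: op_apply)
      have "U (right_reg p G g f) x = U f (x \<otimes> g)"
        using commutes_rightD[OF comm[OF U(1)] g f] bounded_opsD(1)[OF Ub f] x
        by (simp add: right_reg_apply)
      moreover have "right_reg p G g (T f) x = T f (x \<otimes> g)"
        using bounded_opsD(1)[OF Tb f] x by (simp add: right_reg_apply)
      ultimately have "T (right_reg p G g f) x - right_reg p G g (T f) x
          = (T (right_reg p G g f) x - U (right_reg p G g f) x) - (T f (x \<otimes> g) - U f (x \<otimes> g))"
        by simp
      also have "cmod \<dots> \<le> op_norm p (carrier G) ?D * c + op_norm p (carrier G) ?D * c"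
        using norm_triangle_ineq4 D_pointwise[OF gf, of x] D_pointwise[OF f, of "x \<otimes> g"]
        unfolding c_def right_reg_norm[OF g f] by (rule order_trans[OF _ add_mono])
      also have "\<dots> = op_norm p (carrier G) ?D * (2 * c)"
        by simp
      also have "\<dots> \<le> e / (2 * (c + 1)) * (2 * (c + 1))"
        using U(2) c op_norm_nonneg[OF D] e by (intro mult_mono) auto
      also have "\<dots> = 0 + e"
        using c by simp
      finally show ?thesis .
    qed
    then have "cmod (T (right_reg p G g f) x - right_reg p G g (T f) x) \<le> 0"
      by (rule field_le_epsilon)
    then show ?thesis
      by simp
  qed
qed

text \<open>The matrix of \<open>left_reg p G s\<close> lives on the pairs (x, t) with x = s t, and
  all of these are at distance \<open>d s \<one>\<close>.\<close>

lemma left_span_finite_propagation: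
  assumes "proper_metric_group G d" "T \<in> left_span p G"
  shows "propagation (carrier G) d T < \<infinity>"
  using assms(2)
proof (induction rule: left_span.induct)
  case (left_reg s)
  interpret proper_metric_group G d by fact
  have "d x t \<le> d s \<one>"
    if "x \<in> carrier G" "t \<in> carrier G" "matrix_entry (left_reg p G s) x t \<noteq> 0" for x t
  proof -
    have "inv s \<otimes> x = t"
      using that delta_in_lp[of t "carrier G"]
      by (auto simp: matrix_entry_def left_reg_apply delta_def split: if_splits)
    then have "x = s \<otimes> t"
      using that left_reg by (auto simp flip: m_assoc)
    then show ?thesis
      using that left_reg dist_eq_dist_one[of x t] by (simp add: m_assoc)
  qed
  then show ?case
    unfolding propagation_finite_iff by blast
next
  case (add T U)
  then obtain M N where
    "\<forall>s\<in>carrier G. \<forall>t\<in>carrier G. matrix_entry T s t \<noteq> 0 \<longrightarrow> d s t \<le> M"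
    "\<forall>s\<in>carrier G. \<forall>t\<in>carrier G. matrix_entry U s t \<noteq> 0 \<longrightarrow> d s t \<le> N"
    unfolding propagation_finite_iff by blast
  then have "d s t \<le> max M N"
    if "s \<in> carrier G" "t \<in> carrier G" "matrix_entry (op_add p (carrier G) T U) s t \<noteq> 0" for s t
    using that delta_in_lp[of t "carrier G"]
    by (cases "matrix_entry T s t = 0") (fastforce simp: matrix_entry_def op_apply)+
  then show ?case
    unfolding propagation_finite_iff by blast
next
  case (scale T c)
  then show ?case
    using delta_in_lp[of _ "carrier G"]
    unfolding propagation_finite_iff by (fastforce simp: matrix_entry_def op_apply)
qed

text \<open>The span of the translations has finite propagation and commutes with right
  translations, and taking closures preserves both memberships.\<close>

lemma reduced_group_algebra_subset:
  assumes "proper_metric_group G d"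
  shows "reduced_group_algebra p G \<subseteq> invariant_uniform_roe p G d"
proof
  fix T assume T: "T \<in> reduced_group_algebra p G"
  have Tb: "T \<in> bounded_ops p (carrier G)"
    using T op_closure_subset unfolding reduced_group_algebra_eq by blast
  have "T \<in> uniform_roe p (carrier G) d"
  proof -
    have "left_span p G \<subseteq> {T \<in> bounded_ops p (carrier G). propagation (carrier G) d T < \<infinity>}"
      using left_span_bounded left_span_finite_propagation[OF assms] by blast
    then show ?thesis
      using op_closure_mono T unfolding reduced_group_algebra_eq uniform_roe_def by blast
  qed
  moreover have "commutes_right p G T"
    using T left_span_bounded left_span_commutes_right unfolding reduced_group_algebra_eq
    by (intro op_closure_commutes_right[of T "left_span p G"]) auto
  ultimately show "T \<in> invariant_uniform_roe p G d"
    using Ad_right_reg_fixed_iff[OF Tb] by (simp add: invariant_uniform_roe_def)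
qed

end

section \<open>Extension from a subgroup and compression to it\<close>

locale lp_subgroup = lp_group p G + subgroup H G
  for p :: real and G :: "('a, 'b) monoid_scheme" (structure) and H
begin

section \<open>Coset representatives and slices\<close>

abbreviation K where "K \<equiv> G\<lparr>carrier := H\<rparr>"

lemma lp_group_subgroup: "lp_group p K"
  by (intro lp_group.intro lp_exponent_axioms subgroup_is_group group_axioms)

lemma mem_G: "h \<in> H \<Longrightarrow> h \<in> carrier G"
  using subset by blast

lemma inv_K: "h \<in> H \<Longrightarrow> inv\<^bsub>K\<^esub> h = inv h"
  using m_inv_consistent[OF subgroup_axioms] by simp

text \<open>The choice is made from the coset as a set, so points of one coset receive the same
  representative.\<close>

definition rep :: "'a \<Rightarrow> 'a" where "rep x = (SOME y. y \<in> H #> x)"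

abbreviation reps :: "'a set" where "reps \<equiv> rep ` carrier G"

definition slice :: "('a \<Rightarrow> complex) \<Rightarrow> 'a \<Rightarrow> 'a \<Rightarrow> complex" where
  "slice f g = (\<lambda>h. if h \<in> H then f (h \<otimes> g) else 0)"

text \<open>A block diagonal operator with one copy of \<open>S\<close> per right coset, where x = h
  \<otimes> rep x has the coordinate h = x \<otimes> inv (rep x). In general it depends on the
  representatives.\<close>

definition extend_op :: "'a operator \<Rightarrow> 'a operator" where
  "extend_op S = (\<lambda>f\<in>lp_space p (carrier G). \<lambda>x. if x \<in> carrier G
     then S (slice f (rep x)) (x \<otimes> inv (rep x)) else 0)"

definition compress_op :: "'a operator \<Rightarrow> 'a operator" where
  "compress_op U = (\<lambda>f\<in>lp_space p H. \<lambda>x. if x \<in> H then U f x else 0)"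

lemma rep_in_coset: "x \<in> carrier G \<Longrightarrow> rep x \<in> H #> x"
  unfolding rep_def using rcos_self[OF _ subgroup_axioms] by (rule someI)

lemma rep_closed: "x \<in> carrier G \<Longrightarrow> rep x \<in> carrier G"
  using rep_in_coset elemrcos_carrier[OF group_axioms] by blast

lemma rep_mult: "h \<in> H \<Longrightarrow> x \<in> carrier G \<Longrightarrow> rep (h \<otimes> x) = rep x"
  unfolding rep_def
  using coset_mult_assoc[OF subset, of h x] rcos_const[OF group_axioms, of h] mem_G by simp

lemma quotient_in_H:
  assumes "x \<in> carrier G"
  shows "x \<otimes> inv (rep x) \<in> H"
proof -
  obtain h where h: "h \<in> H" "rep x = h \<otimes> x"
    using rep_in_coset[OF assms] by (auto simp: r_coset_def)
  then have "x \<otimes> inv (rep x) = inv h"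
    using assms mem_G by (simp add: inv_mult_group flip: m_assoc)
  then show ?thesis
    using h by simp
qed

lemma quotient_mult_rep: "x \<in> carrier G \<Longrightarrow> x \<otimes> inv (rep x) \<otimes> rep x = x"
  using rep_closed by (simp add: m_assoc)

lemma rep_rep: "x \<in> carrier G \<Longrightarrow> rep (rep x) = rep x"
  using rep_mult[OF quotient_in_H rep_closed, of x x] by (simp add: quotient_mult_rep)

text \<open>Each element is uniquely a product of an element of \<open>H\<close> and a
  representative; sums over \<open>G\<close> thereby become double sums.\<close>

lemma bij_betw_cosets: "bij_betw (\<lambda>(g, h). h \<otimes> g) (reps \<times> H) (carrier G)"
  by (rule bij_betw_byWitness[where f' = "\<lambda>x. (rep x, x \<otimes> inv (rep x))"])
    (auto simp: rep_mult rep_rep rep_closed mem_G m_assoc quotient_in_H)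

lemma lp_H_subset: "f \<in> lp_space p H \<Longrightarrow> f \<in> lp_space p (carrier G)"
  using lp_subset(1)[OF subset] .

lemma slice_lp:
  assumes "f \<in> lp_space p (carrier G)" "g \<in> carrier G"
  shows "slice f g \<in> lp_space p H"
proof -
  have "slice f g = (\<lambda>x. if x \<in> H then right_reg p G g f x else 0)"
    using assms mem_G by (auto simp: slice_def right_reg_apply)
  then show ?thesis
    using lp_restrict(1)[OF subset right_reg_lp[OF assms(2,1)]] by simp
qed

lemma slice_norm_powr: "lp_norm p H (slice f g) powr p = (\<Sum>\<^sub>\<infinity>h\<in>H. cmod (f (h \<otimes> g)) powr p)"
  unfolding lp_norm_powr by (rule infsum_cong) (simp add: slice_def)

text \<open>Fubini for the double sum over cosets and \<open>H\<close>: the space over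
  \<open>G\<close> is the p-direct sum of copies of the space over \<open>H\<close>.\<close>

lemma lp_slices:
  assumes "f \<in> lp_space p (carrier G)"
  shows "(\<lambda>g. lp_norm p H (slice f g) powr p) summable_on reps"
    and "(\<Sum>\<^sub>\<infinity>g\<in>reps. lp_norm p H (slice f g) powr p) = lp_norm p (carrier G) f powr p"
proof -
  let ?F = "\<lambda>(g, h). cmod (f (h \<otimes> g)) powr p"
  have eq: "(\<lambda>x. cmod (f (case x of (g, h) \<Rightarrow> h \<otimes> g)) powr p) = ?F"
    by auto
  have F: "?F summable_on reps \<times> H"
    using summable_on_reindex_bij_betw[OF bij_betw_cosets, of "\<lambda>x. cmod (f x) powr p"]
      lp_space_summable[OF assms] by (simp add: eq)
  show "(\<lambda>g. lp_norm p H (slice f g) powr p) summable_on reps"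
    using summable_on_Sigma_banach[OF F] by (simp add: slice_norm_powr)
  have "(\<Sum>\<^sub>\<infinity>g\<in>reps. lp_norm p H (slice f g) powr p) = infsum ?F (reps \<times> H)"
    using infsum_Sigma_banach[OF F] by (simp add: slice_norm_powr)
  also have "\<dots> = (\<Sum>\<^sub>\<infinity>x\<in>carrier G. cmod (f x) powr p)"
    using infsum_reindex_bij_betw[OF bij_betw_cosets, of "\<lambda>x. cmod (f x) powr p"] by (simp add: eq)
  finally show "(\<Sum>\<^sub>\<infinity>g\<in>reps. lp_norm p H (slice f g) powr p) = lp_norm p (carrier G) f powr p"
    by (simp add: lp_norm_powr)
qed

text \<open>The converse direction, by which an extended operator is seen to map into the sequence
  space over \<open>G\<close>.\<close>

lemma lp_from_slices:
  assumes off: "\<And>x. x \<notin> carrier G \<Longrightarrow> f x = 0"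
    and sl: "\<And>g. g \<in> reps \<Longrightarrow> slice f g \<in> lp_space p H"
    and sum: "(\<lambda>g. lp_norm p H (slice f g) powr p) summable_on reps"
  shows "f \<in> lp_space p (carrier G)"
proof -
  let ?F = "\<lambda>(g, h). cmod (f (h \<otimes> g)) powr p"
  have eq: "(\<lambda>x. cmod (f (case x of (g, h) \<Rightarrow> h \<otimes> g)) powr p) = ?F"
    by auto
  have "?F summable_on reps \<times> H"
  proof (rule summable_on_SigmaI)
    fix g assume g: "g \<in> reps"
    have "(\<lambda>h. cmod (slice f g h) powr p) summable_on H \<longleftrightarrow> (\<lambda>h. cmod (f (h \<otimes> g)) powr p) summable_on H"
      by (rule summable_on_cong) (simp add: slice_def)
    then show "((\<lambda>h. ?F (g, h)) has_sum lp_norm p H (slice f g) powr p) H"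
      using lp_space_summable[OF sl[OF g]] by (simp add: slice_norm_powr)
  qed (use sum in auto)
  then show ?thesis
    using summable_on_reindex_bij_betw[OF bij_betw_cosets, of "\<lambda>x. cmod (f x) powr p"] off
    by (simp add: eq lp_space_def)
qed

section \<open>Blockwise extension\<close>

text \<open>A representative represents itself, so h \<otimes> g has coordinate h. Off
  \<open>H\<close> both sides vanish.\<close>

lemma slice_extend:
  assumes f: "f \<in> lp_space p (carrier G)" and g: "g \<in> reps"
    and S: "S \<in> bounded_ops p H"
  shows "slice (extend_op S f) g = S (slice f g)"
proof
  fix h
  from g obtain x where x: "x \<in> carrier G" "g = rep x"
    by blast
  have sg: "S (slice f g) \<in> lp_space p H"
    using bounded_opsD(1)[OF S slice_lp[OF f]] x rep_closed by simp
  show "slice (extend_op S f) g h = S (slice f g) h"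
    using lp_space_off[OF sg] f x
    by (simp add: slice_def extend_op_def rep_mult rep_rep rep_closed mem_G m_assoc)
qed

text \<open>All blocks are copies of \<open>S\<close> and share its norm as a bound; summing the
  p-th powers of the slice norms keeps that factor.\<close>

lemma extend_lp:
  assumes S: "S \<in> bounded_ops p H" and f: "f \<in> lp_space p (carrier G)"
  shows "extend_op S f \<in> lp_space p (carrier G)"
    and "lp_norm p (carrier G) (extend_op S f) \<le> op_norm p H S * lp_norm p (carrier G) f"
proof -
  let ?C = "op_norm p H S"
  have repG: "g \<in> carrier G" if "g \<in> reps" for g
    using that rep_closed by blast
  have le: "lp_norm p H (slice (extend_op S f) g) powr p \<le> ?C powr p * lp_norm p H (slice f g) powr p"
    if "g \<in> reps" for g
  proof -
    have "lp_norm p H (slice (extend_op S f) g) powr p \<le> (?C * lp_norm p H (slice f g)) powr p"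
      using op_norm_bound[OF S slice_lp[OF f repG[OF that]]] p
      by (intro powr_mono2) (auto simp: slice_extend[OF f that S])
    then show ?thesis
      using op_norm_nonneg[OF S] by (simp add: powr_mult)
  qed
  have sum: "(\<lambda>g. ?C powr p * lp_norm p H (slice f g) powr p) summable_on reps"
    by (intro summable_on_cmult_right lp_slices(1) f)
  have sum': "(\<lambda>g. lp_norm p H (slice (extend_op S f) g) powr p) summable_on reps"
    using sum by (rule summable_on_comparison_test) (use le in auto)
  show lp: "extend_op S f \<in> lp_space p (carrier G)"
  proof (rule lp_from_slices[OF _ _ sum'])
    show "extend_op S f x = 0" if "x \<notin> carrier G" for x
      using f that by (simp add: extend_op_def)
    show "slice (extend_op S f) g \<in> lp_space p H" if "g \<in> reps" for g
      unfolding slice_extend[OF f that S] by (intro bounded_opsD(1)[OF S] slice_lp f repG that)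
  qed
  have "lp_norm p (carrier G) (extend_op S f) powr p \<le> ?C powr p * lp_norm p (carrier G) f powr p"
    unfolding lp_slices(2)[OF lp, symmetric] lp_slices(2)[OF f, symmetric]
      infsum_cmult_right'[symmetric]
    by (rule infsum_mono[OF sum' sum le])
  also have "\<dots> = (?C * lp_norm p (carrier G) f) powr p"
    using op_norm_nonneg[OF S] by (simp add: powr_mult)
  finally show "lp_norm p (carrier G) (extend_op S f) \<le> ?C * lp_norm p (carrier G) f"
    using p op_norm_nonneg[OF S]
    by (meson lp_norm_nonneg less_trans mult_nonneg_nonneg not_le powr_less_mono2 zero_less_one)
qed

lemma extend_bounded:
  assumes S: "S \<in> bounded_ops p H"
  shows "extend_op S \<in> bounded_ops p (carrier G)"
    and "op_norm p (carrier G) (extend_op S) \<le> op_norm p H S"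
proof -
  show "extend_op S \<in> bounded_ops p (carrier G)"
  proof (rule bounded_opsI[OF _ extend_lp(1)[OF S] _ _ extend_lp(2)[OF S]])
    fix f g :: "'a \<Rightarrow> complex" and c assume f: "f \<in> lp_space p (carrier G)"
    have "slice (\<lambda>x. c * f x) y = (\<lambda>x. c * slice f y x)" for y
      by (auto simp: slice_def)
    then show "extend_op S (\<lambda>x. c * f x) = (\<lambda>x. c * extend_op S f x)"
      by (intro ext) (simp add: extend_op_def f lp_scale bounded_opsD(4)[OF S] slice_lp rep_closed)
    assume g: "g \<in> lp_space p (carrier G)"
    have "slice (\<lambda>x. f x + g x) y = (\<lambda>x. slice f y x + slice g y x)" for y
      by (auto simp: slice_def)
    then show "extend_op S (\<lambda>x. f x + g x) = (\<lambda>x. extend_op S f x + extend_op S g x)"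
      by (intro ext) (simp add: extend_op_def f g lp_add bounded_opsD(3)[OF S] slice_lp rep_closed)
  qed (simp add: extend_op_def)
  show "op_norm p (carrier G) (extend_op S) \<le> op_norm p H S"
    by (rule op_norm_leI[OF op_norm_nonneg[OF S] extend_lp(2)[OF S]])
qed

lemma extend_diff: "op_diff p (carrier G) (extend_op S) (extend_op T) = extend_op (op_diff p H S T)"
  by (rule ext) (auto simp: op_diff_def extend_op_def slice_lp rep_closed fun_eq_iff)

text \<open>A nonzero entry of the extension at (x, t) comes from an entry of \<open>S\<close> with
  the same quotient x t^{-1}, whatever the coset.\<close>

lemma extend_finite_propagation:
  assumes d: "proper_metric_group G d" and dH: "proper_metric_group K dH"
    and S: "S \<in> bounded_ops p H" and fin: "propagation H dH S < \<infinity>"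
  shows "propagation (carrier G) d (extend_op S) < \<infinity>"
proof -
  interpret dG: proper_metric_group G d by fact
  interpret dK: proper_metric_group K dH by fact
  obtain N where N: "\<And>s t. s \<in> H \<Longrightarrow> t \<in> H \<Longrightarrow> matrix_entry S s t \<noteq> 0 \<Longrightarrow> dH s t \<le> N"
    using fin unfolding propagation_finite_iff by blast
  \<comment> \<open>The passage between the metrics: a \<open>dH\<close>-ball is a finite set, so
    \<open>d\<close> is bounded on it.\<close>
  have "finite (dK.mcball \<one> N)"
    using dK.finite_balls[of \<one> N] by simp
  then obtain M where M: "\<And>h. h \<in> dK.mcball \<one> N \<Longrightarrow> d h \<one> \<le> M"
    using bdd_above_finite[of "(\<lambda>h. d h \<one>) ` dK.mcball \<one> N"] by (auto simp: bdd_above_def)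
  have "d x t \<le> M"
    if x: "x \<in> carrier G" and t: "t \<in> carrier G" and nz: "matrix_entry (extend_op S) x t \<noteq> 0" for x t
  proof -
    \<comment> \<open>\<open>u\<close> and \<open>v\<close> are the coordinates of \<open>t\<close>
      and \<open>x\<close> relative to the base point of the coset of \<open>x\<close>; that
      \<open>u\<close> lies in \<open>H\<close> is still open.\<close>
    define r u v where "r = rep x" and "u = t \<otimes> inv r" and "v = x \<otimes> inv r"
    have r: "r \<in> carrier G" and v: "v \<in> H"
      using rep_closed[OF x] quotient_in_H[OF x] by (auto simp: r_def v_def)
    have nz': "S (slice (delta t) r) v \<noteq> 0"
      using nz x delta_in_lp[OF t] by (simp add: matrix_entry_def extend_op_def r_def v_def)
    have mult_eq: "h \<otimes> r = t \<longleftrightarrow> h = u" if "h \<in> carrier G" for h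
      using that r t unfolding u_def by (metis inv_closed inv_solve_right m_closed)
    \<comment> \<open>If \<open>t\<close> were in another coset, the slice of \<open>delta t\<close>
      would be zero and so would the entry.\<close>
    have u: "u \<in> H"
    proof (rule ccontr)
      assume "u \<notin> H"
      then have "slice (delta t) r = (\<lambda>x. 0)"
        using mult_eq mem_G by (auto simp: slice_def delta_def fun_eq_iff)
      then show False
        using nz' bounded_ops_zero[OF S] by simp
    qed
    then have "slice (delta t) r = delta u"
      using mult_eq mem_G by (auto simp: slice_def delta_def fun_eq_iff)
    then have "dH v u \<le> N"
      using nz' N[OF v u] by (simp add: matrix_entry_def)
    then have "dH (v \<otimes> inv u) \<one> \<le> N"
      using dK.dist_eq_dist_one[of v u] u v by (simp add: inv_K)
    then have "v \<otimes> inv u \<in> dK.mcball \<one> N"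
      unfolding dK.in_mcball using u v by (simp add: dK.commute)
    moreover have "v \<otimes> inv u = x \<otimes> inv t"
      using x t r by (simp add: u_def v_def inv_mult_group m_assoc) (simp flip: m_assoc)
    ultimately show ?thesis
      using M dG.dist_eq_dist_one[OF x t] by metis
  qed
  then show ?thesis
    unfolding propagation_finite_iff by blast
qed

text \<open>Extension is contractive and respects differences, so extending finite propagation
  approximants of \<open>T\<close> approximates the extension of \<open>T\<close>.\<close>

lemma extend_uniform_roe:
  assumes d: "proper_metric_group G d" and dH: "proper_metric_group K dH"
    and T: "T \<in> uniform_roe p H dH"
  shows "extend_op T \<in> uniform_roe p (carrier G) d"
proof -
  have Tb: "T \<in> bounded_ops p H"
    using T op_closure_subset unfolding uniform_roe_def by blast
  have "\<exists>V\<in>{V \<in> bounded_ops p (carrier G). propagation (carrier G) d V < \<infinity>}.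
      op_norm p (carrier G) (op_diff p (carrier G) (extend_op T) V) < e" if e: "0 < e" for e
  proof -
    obtain S where S: "S \<in> bounded_ops p H" "propagation H dH S < \<infinity>" "op_norm p H (op_diff p H T S) < e"
      using op_closureE[OF T[unfolded uniform_roe_def] e] by blast
    then show ?thesis
      using extend_bounded(1)[OF S(1)] extend_finite_propagation[OF d dH S(1,2)]
        extend_bounded(2)[OF op_diff_bounded[OF Tb S(1)]]
      by (intro bexI[of _ "extend_op S"]) (auto simp: extend_diff)
  qed
  then show ?thesis
    using extend_bounded(1)[OF Tb] by (simp add: uniform_roe_def op_closure_def)
qed

text \<open>Any \<open>g\<close> can replace \<open>rep g\<close> as base point: the change
  translates the slice on the right by an element of \<open>H\<close>, and \<open>T\<close> commutes
  with that. Thus the extension of an invariant operator is independent of the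
  representatives.\<close>

lemma extend_coset:
  assumes T: "T \<in> bounded_ops p H" and comm: "commutes_right p K T"
    and f: "f \<in> lp_space p (carrier G)" and h: "h \<in> H" and g: "g \<in> carrier G"
  shows "extend_op T f (h \<otimes> g) = T (slice f g) h"
proof -
  define k where "k = g \<otimes> inv (rep g)"
  have k: "k \<in> H"
    using quotient_in_H[OF g] by (simp add: k_def)
  note r = rep_closed[OF g]
  note sr = slice_lp[OF f r]
  have g_eq: "g = k \<otimes> rep g"
    using quotient_mult_rep[OF g] by (simp add: k_def)
  have "slice f g = right_reg p K k (slice f (rep g))"
  proof
    fix y
    show "slice f g y = right_reg p K k (slice f (rep g)) y"
      using sr k mem_G r by (subst g_eq) (simp add: right_reg_apply slice_def m_assoc)
  qed
  then have "T (slice f g) = right_reg p K k (T (slice f (rep g)))"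
    using commutes_rightD[OF comm, of k] k sr by simp
  then have "T (slice f g) h = T (slice f (rep g)) (h \<otimes> k)"
    using bounded_opsD(1)[OF T sr] h by (simp add: right_reg_apply)
  moreover have "h \<otimes> g \<otimes> inv (rep g) = h \<otimes> k"
    using h g r mem_G by (simp add: k_def m_assoc)
  ultimately show ?thesis
    using f h g mem_G by (simp add: extend_op_def rep_mult)
qed

text \<open>With base points \<open>x\<close> and \<open>x \<otimes> g\<close> the slices of the
  translated and the original function agree exactly; both sides are then read off at h =
  \<one>.\<close>

lemma extend_commutes_right:
  assumes T: "T \<in> bounded_ops p H" and comm: "commutes_right p K T"
  shows "commutes_right p G (extend_op T)"
  unfolding commutes_right_def
proof (intro ballI ext)
  fix g f x assume g: "g \<in> carrier G" and f: "f \<in> lp_space p (carrier G)"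
  note gf = right_reg_lp[OF g f]
  note Ef = extend_lp(1)[OF T f]
  show "extend_op T (right_reg p G g f) x = right_reg p G g (extend_op T f) x"
  proof (cases "x \<in> carrier G")
    case x: True
    have "slice (right_reg p G g f) x = slice f (x \<otimes> g)"
      using x g f mem_G by (auto simp: slice_def right_reg_apply m_assoc fun_eq_iff)
    then show ?thesis
      using extend_coset[OF T comm gf one_closed x] extend_coset[OF T comm f one_closed, of "x \<otimes> g"]
        x g Ef by (simp add: right_reg_apply)
  next
    case False
    then show ?thesis
      using gf Ef by (simp add: extend_op_def right_reg_apply)
  qed
qed

section \<open>Compression to the subgroup\<close>

text \<open>With base point \<one> the block over the coset \<open>H\<close> is \<open>T\<close>
  itself. The chosen representative of \<open>H\<close> may be a different element, so invariance of
  \<open>T\<close> enters through \<open>extend_coset\<close>.\<close>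

lemma compress_extend:
  assumes T: "T \<in> bounded_ops p H" and comm: "commutes_right p K T"
  shows "compress_op (extend_op T) = T"
proof
  fix f
  show "compress_op (extend_op T) f = T f"
  proof (cases "f \<in> lp_space p H")
    case f: True
    have "slice f \<one> = f"
      using mem_G lp_space_off[OF f] by (auto simp: slice_def fun_eq_iff)
    then show ?thesis
      using extend_coset[OF T comm lp_H_subset[OF f], of _ \<one>] f mem_G
        lp_space_off[OF bounded_opsD(1)[OF T f]]
      by (intro ext) (auto simp: compress_op_def)
  next
    case False
    then show ?thesis
      using bounded_opsD(2)[OF T] by (simp add: compress_op_def)
  qed
qed

lemma compress_norm:
  assumes U: "U \<in> bounded_ops p (carrier G)"
  shows "op_norm p H (compress_op U) \<le> op_norm p (carrier G) U"
proof (rule op_norm_leI[OF op_norm_nonneg[OF U]])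
  fix f assume f: "f \<in> lp_space p H"
  note fG = lp_H_subset[OF f]
  show "lp_norm p H (compress_op U f) \<le> op_norm p (carrier G) U * lp_norm p H f"
    using order_trans[OF lp_restrict(2)[OF subset bounded_opsD(1)[OF U fG]] op_norm_bound[OF U fG]]
      lp_subset(2)[OF subset f] f by (simp add: compress_op_def)
qed

lemma compress_diff: "op_diff p H (compress_op S) (compress_op T) = compress_op (op_diff p (carrier G) S T)"
  using lp_H_subset by (auto simp: op_diff_def compress_op_def fun_eq_iff)

text \<open>For s outside \<open>H\<close>, translation by s moves \<open>H\<close> off itself. The
  resulting zero operator is written as a multiple of a translation, which places it in the
  span.\<close>

lemma compress_left_reg:
  assumes s: "s \<in> carrier G"
  shows "compress_op (left_reg p G s) = (if s \<in> H then left_reg p K s else op_scale p H 0 (left_reg p K \<one>))"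
proof
  fix f
  have "inv s \<otimes> t \<notin> H" if "s \<notin> H" "t \<in> H" for t
  proof
    assume "inv s \<otimes> t \<in> H"
    then have "t \<otimes> inv (inv s \<otimes> t) \<in> H"
      using that by simp
    then show False
      using that s mem_G by (simp add: inv_mult_group flip: m_assoc)
  qed
  then show "compress_op (left_reg p G s) f
      = (if s \<in> H then left_reg p K s else op_scale p H 0 (left_reg p K \<one>)) f"
    using lp_H_subset[of f] lp_space_off[of f p H] mem_G
    by (auto simp: compress_op_def left_reg_def op_scale_def inv_K fun_eq_iff)
qed

lemma compress_left_span:
  assumes "U \<in> left_span p G"
  shows "compress_op U \<in> left_span p K"
  using assms
proof (induction rule: left_span.induct)
  case (left_reg s)
  then show ?case
    using left_span.left_reg[of s K p] left_span.scale[OF left_span.left_reg[of \<one> K p], of 0]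
    by (simp add: compress_left_reg)
next
  case (add T U)
  have "compress_op (op_add p (carrier G) T U) = op_add p H (compress_op T) (compress_op U)"
    using lp_H_subset by (auto simp: compress_op_def op_add_def fun_eq_iff)
  then show ?case
    using left_span.add[OF add.IH] by simp
next
  case (scale T c)
  have "compress_op (op_scale p (carrier G) c T) = op_scale p H c (compress_op T)"
    using lp_H_subset by (auto simp: compress_op_def op_scale_def fun_eq_iff)
  then show ?case
    using left_span.scale[OF scale.IH, of c] by simp
qed

lemma p_ITAP_subgroup:
  assumes d: "proper_metric_group G d" and dH: "proper_metric_group K dH" and ITAP: "p_ITAP p G d"
  shows "p_ITAP p K dH"
proof -
  interpret HK: lp_group p K
    by (rule lp_group_subgroup)
  have "T \<in> reduced_group_algebra p K" if T: "T \<in> invariant_uniform_roe p K dH" for T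
  proof -
    have Tr: "T \<in> uniform_roe p H dH"
      using T by (simp add: invariant_uniform_roe_def)
    then have Tb: "T \<in> bounded_ops p H"
      using op_closure_subset unfolding uniform_roe_def by blast
    have comm: "commutes_right p K T"
      using T Tb HK.Ad_right_reg_fixed_iff[of T] by (simp add: invariant_uniform_roe_def)
    have "extend_op T \<in> invariant_uniform_roe p G d"
      using extend_uniform_roe[OF d dH Tr] extend_commutes_right[OF Tb comm]
        Ad_right_reg_fixed_iff[OF extend_bounded(1)[OF Tb]]
      by (simp add: invariant_uniform_roe_def)
    then have E: "extend_op T \<in> op_closure p (carrier G) (left_span p G)"
      using ITAP by (simp add: p_ITAP_def reduced_group_algebra_eq)
    have "\<exists>V\<in>left_span p K. op_norm p H (op_diff p H T V) < e" if e: "0 < e" for e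
    proof -
      obtain U where U: "U \<in> left_span p G" "op_norm p (carrier G) (op_diff p (carrier G) (extend_op T) U) < e"
        using op_closureE[OF E e] by blast
      \<comment> \<open>Compression undoes the extension, so this error is the compression of the
        error over \<open>G\<close> and is no larger.\<close>
      have "op_diff p H T (compress_op U) = compress_op (op_diff p (carrier G) (extend_op T) U)"
        using compress_diff[of "extend_op T" U] compress_extend[OF Tb comm] by simp
      then show ?thesis
        using U compress_left_span[OF U(1)]
          compress_norm[OF op_diff_bounded[OF extend_bounded(1)[OF Tb] left_span_bounded[OF U(1)]]]
        by (intro bexI[of _ "compress_op U"]) auto
    qed
    then show ?thesis
      using Tb by (simp add: HK.reduced_group_algebra_eq op_closure_def)
  qed
  then show ?thesis
    using HK.reduced_group_algebra_subset[OF dH] unfolding p_ITAP_def by blast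
qed

end

theorem proposition4p10:
  fixes p :: real and G :: "('a, 'b) monoid_scheme" and H :: "'a set"
    and d dH :: "'a \<Rightarrow> 'a \<Rightarrow> real"
  assumes "1 < p"
    and "proper_metric_group G d"
    and "subgroup H G"
    and "proper_metric_group (G\<lparr>carrier := H\<rparr>) dH"
    and "p_ITAP p G d"
  shows "p_ITAP p (G\<lparr>carrier := H\<rparr>) dH"
proof -
  interpret proper_metric_group G d by fact
  interpret lp_subgroup p G H
    using assms(1,3) by (intro lp_subgroup.intro lp_group.intro lp_exponent.intro group_axioms)
  show ?thesis
    using assms(2,4,5) by (rule p_ITAP_subgroup)
qed

end
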